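(* Let $M$ be a closed $C^\infty$ manifold and let $f$ be a $C^1$ diffeomorphism of $M$ with the two-sided limit shadowing property. Then $f$ has neither sinks nor sources. If, in addition, $f$ is Axiom A, then $f$ is a transitive Anosov diffeomorphism. In particular, Morse-Smale diffeomorphisms of $M$ do not have the two-sided limit shadowing property.
   Context: $M$ carries a Riemannian metric $\|\cdot\|$ and $d$ is the induced distance. Closed means compact without boundary. Two-sided limit shadowing: a sequence $(x_i)_{i\in\mathbb{Z}}$ in $M$ is a two-sided limit pseudo-orbit of $f$ if $d(f(x_i),x_{i+1})\to 0$ as $|i|\to\infty$. It is two-sided limit-shadowed if there is $y\in M$ with $d(f^i(y),x_i)\to 0$ as $|i|\to\infty$. The map $f$ has the two-sided limit shadowing property if every two-sided limit pseudo-orbit of $f$ is two-sided limit-shadowed. Hyperbolicity: let $\Lambda\subset M$ be a compact $f$-invariant set. A linear subbundle $E$ of $T_\Lambda M$ is uniformly contracted by $f$ if it is $Df$-invariant and there is $N\ge 1$ such that $\|Df^N(x)v\|<\frac12$ for every $x\in\Lambda$ and every unit vector $v\in E_x$. It is uniformly expanded if it is uniformly contracted by $f^{-1}$. The set $\Lambda$ is hyperbolic if $T_\Lambda M=E\oplus F$ with $E$ (the stable bundle) uniformly contracted and $F$ (the unstable bundle) uniformly expanded. The diffeomorphism $f$ is Anosov if the whole manifold $M$ is hyperbolic. It is transitive if there is a point $x$ whose orbit $\{f^i(x): i\in\mathbb{Z}\}$ is dense in $M$. Periodic points: $p$ is periodic if $f^n(p)=p$ for some integer $n\ge 1$; $Per(f)$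 is the set of periodic points. A periodic point $p$ is hyperbolic if its orbit is a hyperbolic set; its index is the dimension of the stable bundle. A hyperbolic periodic point is a sink if its index equals $\dim M$, and a source if its index is $0$. A point $p$ is non-wandering if for every neighborhood $U$ of $p$ there is an integer $n\ge 1$ with $f^n(U)\cap U\ne\emptyset$; $\Omega(f)$ is the set of non-wandering points. The diffeomorphism $f$ is Axiom A if $\Omega(f)=\overline{Per(f)}$ and $\Omega(f)$ is a hyperbolic set. It is Morse-Smale if $\Omega(f)$ is a finite union of hyperbolic periodic points all of whose invariant (stable and unstable) manifolds are in general position (i.e. intersect transversally). *)

theory Defs
  imports "HOL-Analysis.Analysis"
begin

section \<open>Smooth manifolds\<close>

text \<open>
  The manifold is the whole type \<open>'m\<close> and is modelled on \<open>'e\<close>; a chart is a pair of a domain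
  and a coordinate map, whose values outside the domain are irrelevant. Since \<open>'e\<close> is a
  Euclidean space, its dimension is at least 1.
\<close>

type_synonym ('m, 'e) chart = "'m set \<times> ('m \<Rightarrow> 'e)"

abbreviation chart_inv :: "('m, 'e) chart \<Rightarrow> 'e \<Rightarrow> 'm"
  where "chart_inv c \<equiv> inv_into (fst c) (snd c)"

text \<open>The following is only meant for open sets \<open>S\<close>.\<close>

primrec Ck_on :: "nat \<Rightarrow> ('a::euclidean_space \<Rightarrow> 'b::real_normed_vector) \<Rightarrow> 'a set \<Rightarrow> bool" where
  "Ck_on 0 = (\<lambda>f S. continuous_on S f)"
| "Ck_on (Suc k) = (\<lambda>f S. f differentiable_on S \<and>
      (\<forall>v. Ck_on k (\<lambda>x. frechet_derivative f (at x) v) S))"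

definition is_chart :: "('m::topological_space, 'e::euclidean_space) chart \<Rightarrow> bool" where
  "is_chart c \<longleftrightarrow> open (fst c) \<and> open (snd c ` fst c) \<and>
     homeomorphism (fst c) (snd c ` fst c) (snd c) (chart_inv c)"

definition smooth_atlas :: "('m::topological_space, 'e::euclidean_space) chart set \<Rightarrow> bool" where
  "smooth_atlas A \<longleftrightarrow> (\<forall>c\<in>A. is_chart c) \<and> (\<Union>c\<in>A. fst c) = UNIV \<and>
     (\<forall>c\<in>A. \<forall>c'\<in>A. \<forall>k. Ck_on k (snd c' \<circ> chart_inv c) (snd c ` (fst c \<inter> fst c')))"

definition C1_map ::
  "('m::topological_space, 'e::euclidean_space) chart set \<Rightarrow> ('m \<Rightarrow> 'm) \<Rightarrow> bool" where
  "C1_map A f \<longleftrightarrow> continuous_on UNIV f \<and>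
     (\<forall>c\<in>A. \<forall>c'\<in>A. Ck_on 1 (snd c' \<circ> f \<circ> chart_inv c) (snd c ` (fst c \<inter> f -` fst c')))"

definition C1_diffeo ::
  "('m::topological_space, 'e::euclidean_space) chart set \<Rightarrow> ('m \<Rightarrow> 'm) \<Rightarrow> bool" where
  "C1_diffeo A f \<longleftrightarrow> bij f \<and> C1_map A f \<and> C1_map A (inv f)"

section \<open>Tangent vectors\<close>

text \<open>
  Every point \<open>x\<close> has a preferred chart \<open>chart_at A x\<close> around it, and the tangent space at \<open>x\<close> is
  identified with \<open>'e\<close> through it: an element of \<open>'e\<close>, regarded as a tangent vector at \<open>x\<close>, is the
  vector with these components in the preferred chart. All notions below are independent of the
  choice of the preferred charts, because they are expressed through coordinate changes.
\<close>

definition chart_at :: "('m, 'e) chart set \<Rightarrow> 'm \<Rightarrow> ('m, 'e) chart" where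
  "chart_at A x = (SOME c. c \<in> A \<and> x \<in> fst c)"

definition chart_deriv ::
  "('m, 'e::euclidean_space) chart \<Rightarrow> ('m, 'e) chart \<Rightarrow> ('m \<Rightarrow> 'm) \<Rightarrow> 'm \<Rightarrow> 'e \<Rightarrow> 'e" where
  "chart_deriv c c' f x = frechet_derivative (snd c' \<circ> f \<circ> chart_inv c) (at (snd c x))"

definition differential ::
  "('m, 'e::euclidean_space) chart set \<Rightarrow> ('m \<Rightarrow> 'm) \<Rightarrow> 'm \<Rightarrow> 'e \<Rightarrow> 'e" where
  "differential A f x = chart_deriv (chart_at A x) (chart_at A (f x)) f x"

text \<open>Passage from tangent vectors at \<open>x\<close> to their components in the chart \<open>c\<close>, and back.\<close>

definition to_chart ::
  "('m, 'e::euclidean_space) chart set \<Rightarrow> ('m, 'e) chart \<Rightarrow> 'm \<Rightarrow> 'e \<Rightarrow> 'e" where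
  "to_chart A c x = chart_deriv (chart_at A x) c id x"

definition from_chart ::
  "('m, 'e::euclidean_space) chart set \<Rightarrow> ('m, 'e) chart \<Rightarrow> 'm \<Rightarrow> 'e \<Rightarrow> 'e" where
  "from_chart A c x = chart_deriv c (chart_at A x) id x"

definition C1_curve_on ::
  "('m::topological_space, 'e::euclidean_space) chart set \<Rightarrow> real set \<Rightarrow> (real \<Rightarrow> 'm) \<Rightarrow> bool" where
  "C1_curve_on A I \<gamma> \<longleftrightarrow> continuous_on I \<gamma> \<and>
     (\<forall>c\<in>A. (snd c \<circ> \<gamma>) C1_differentiable_on (I \<inter> \<gamma> -` fst c))"

definition velocity ::
  "('m, 'e::euclidean_space) chart set \<Rightarrow> (real \<Rightarrow> 'm) \<Rightarrow> real \<Rightarrow> 'e" where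
  "velocity A \<gamma> t = vector_derivative (snd (chart_at A (\<gamma> t)) \<circ> \<gamma>) (at t)"

section \<open>Riemannian metrics and the induced distance\<close>

type_synonym ('m, 'e) metric_tensor = "'m \<Rightarrow> 'e \<Rightarrow> 'e \<Rightarrow> real"

definition riemannian_metric ::
  "('m::topological_space, 'e::euclidean_space) chart set \<Rightarrow> ('m, 'e) metric_tensor \<Rightarrow> bool" where
  "riemannian_metric A g \<longleftrightarrow>
     (\<forall>x. bilinear (g x) \<and> (\<forall>u v. g x u v = g x v u) \<and> (\<forall>v. v \<noteq> 0 \<longrightarrow> g x v v > 0)) \<and>
     (\<forall>c\<in>A. \<forall>u v k.
        Ck_on k (\<lambda>z. g (chart_inv c z) (from_chart A c (chart_inv c z) u)
                                       (from_chart A c (chart_inv c z) v)) (snd c ` fst c))"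

definition tnorm :: "('m, 'e) metric_tensor \<Rightarrow> 'm \<Rightarrow> 'e \<Rightarrow> real" where
  "tnorm g x v = sqrt (g x v v)"

definition piecewise_C1_curve ::
  "('m::topological_space, 'e::euclidean_space) chart set \<Rightarrow> (real \<Rightarrow> 'm) \<Rightarrow> bool" where
  "piecewise_C1_curve A \<gamma> \<longleftrightarrow> path \<gamma> \<and> (\<exists>S. finite S \<and> C1_curve_on A ({0<..<1} - S) \<gamma>)"

definition curve_length ::
  "('m, 'e::euclidean_space) chart set \<Rightarrow> ('m, 'e) metric_tensor \<Rightarrow> (real \<Rightarrow> 'm) \<Rightarrow> ennreal" where
  "curve_length A g \<gamma> = (\<integral>\<^sup>+t\<in>{0..1}. ennreal (tnorm g (\<gamma> t) (velocity A \<gamma> t)) \<partial>lborel)"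

text \<open>Points in different connected components are at infinite distance.\<close>

definition riem_dist ::
  "('m::topological_space, 'e::euclidean_space) chart set \<Rightarrow> ('m, 'e) metric_tensor
     \<Rightarrow> 'm \<Rightarrow> 'm \<Rightarrow> ennreal" where
  "riem_dist A g x y =
     (INF \<gamma>\<in>{\<gamma>. piecewise_C1_curve A \<gamma> \<and> pathstart \<gamma> = x \<and> pathfinish \<gamma> = y}. curve_length A g \<gamma>)"

section \<open>Two-sided limit shadowing\<close>

definition int_iter :: "('m \<Rightarrow> 'm) \<Rightarrow> int \<Rightarrow> 'm \<Rightarrow> 'm" where
  "int_iter f i = (if i \<ge> 0 then f ^^ nat i else inv f ^^ nat (- i))"

definition orbit :: "('m \<Rightarrow> 'm) \<Rightarrow> 'm \<Rightarrow> 'm set" where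
  "orbit f x = range (\<lambda>i. int_iter f i x)"

definition two_sided_limit_pseudo_orbit ::
  "('m::topological_space, 'e::euclidean_space) chart set \<Rightarrow> ('m, 'e) metric_tensor
     \<Rightarrow> ('m \<Rightarrow> 'm) \<Rightarrow> (int \<Rightarrow> 'm) \<Rightarrow> bool" where
  "two_sided_limit_pseudo_orbit A g f x \<longleftrightarrow>
     ((\<lambda>i. riem_dist A g (f (x i)) (x (i + 1))) \<longlongrightarrow> 0) (filtercomap abs at_top)"

definition two_sided_limit_shadowed ::
  "('m::topological_space, 'e::euclidean_space) chart set \<Rightarrow> ('m, 'e) metric_tensor
     \<Rightarrow> ('m \<Rightarrow> 'm) \<Rightarrow> (int \<Rightarrow> 'm) \<Rightarrow> bool" where
  "two_sided_limit_shadowed A g f x \<longleftrightarrow>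
     (\<exists>y. ((\<lambda>i. riem_dist A g (int_iter f i y) (x i)) \<longlongrightarrow> 0) (filtercomap abs at_top))"

definition two_sided_limit_shadowing ::
  "('m::topological_space, 'e::euclidean_space) chart set \<Rightarrow> ('m, 'e) metric_tensor
     \<Rightarrow> ('m \<Rightarrow> 'm) \<Rightarrow> bool" where
  "two_sided_limit_shadowing A g f \<longleftrightarrow>
     (\<forall>x. two_sided_limit_pseudo_orbit A g f x \<longrightarrow> two_sided_limit_shadowed A g f x)"

section \<open>Hyperbolicity\<close>

text \<open>
  A linear subbundle of the tangent bundle over \<open>\<Lambda>\<close>, given by its fibres \<open>E x\<close>: near every point of
  \<open>\<Lambda>\<close> there is a continuous frame \<open>e 0, \<dots>, e (k - 1)\<close> of \<open>E\<close>. The rank is only locally constant.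
\<close>

definition subbundle ::
  "('m::topological_space, 'e::euclidean_space) chart set \<Rightarrow> 'm set \<Rightarrow> ('m \<Rightarrow> 'e set) \<Rightarrow> bool" where
  "subbundle A \<Lambda> E \<longleftrightarrow>
     (\<forall>x\<in>\<Lambda>. \<exists>c\<in>A. \<exists>V. open V \<and> x \<in> V \<and> V \<subseteq> fst c \<and>
        (\<exists>(k::nat) (e::nat \<Rightarrow> 'm \<Rightarrow> 'e).
           (\<forall>i<k. continuous_on (V \<inter> \<Lambda>) (\<lambda>y. to_chart A c y (e i y))) \<and>
           (\<forall>y\<in>V \<inter> \<Lambda>. inj_on (\<lambda>i. e i y) {..<k} \<and> independent ((\<lambda>i. e i y) ` {..<k}) \<and>
                        E y = span ((\<lambda>i. e i y) ` {..<k}))))"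

definition uniformly_contracted ::
  "('m::topological_space, 'e::euclidean_space) chart set \<Rightarrow> ('m, 'e) metric_tensor
     \<Rightarrow> ('m \<Rightarrow> 'm) \<Rightarrow> 'm set \<Rightarrow> ('m \<Rightarrow> 'e set) \<Rightarrow> bool" where
  "uniformly_contracted A g f \<Lambda> E \<longleftrightarrow>
     (\<forall>x\<in>\<Lambda>. differential A f x ` E x = E (f x)) \<and>
     (\<exists>N\<ge>1. \<forall>x\<in>\<Lambda>. \<forall>v\<in>E x. tnorm g x v = 1 \<longrightarrow>
        tnorm g ((f ^^ N) x) (differential A (f ^^ N) x v) < 1 / 2)"

definition hyperbolic_splitting ::
  "('m::topological_space, 'e::euclidean_space) chart set \<Rightarrow> ('m, 'e) metric_tensor
     \<Rightarrow> ('m \<Rightarrow> 'm) \<Rightarrow> 'm set \<Rightarrow> ('m \<Rightarrow> 'e set) \<Rightarrow> ('m \<Rightarrow> 'e set) \<Rightarrow> bool" where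
  "hyperbolic_splitting A g f \<Lambda> E F \<longleftrightarrow>
     subbundle A \<Lambda> E \<and> subbundle A \<Lambda> F \<and>
     (\<forall>x\<in>\<Lambda>. E x \<inter> F x = {0} \<and> {u + v |u v. u \<in> E x \<and> v \<in> F x} = UNIV) \<and>
     uniformly_contracted A g f \<Lambda> E \<and> uniformly_contracted A g (inv f) \<Lambda> F"

definition hyperbolic_set ::
  "('m::topological_space, 'e::euclidean_space) chart set \<Rightarrow> ('m, 'e) metric_tensor
     \<Rightarrow> ('m \<Rightarrow> 'm) \<Rightarrow> 'm set \<Rightarrow> bool" where
  "hyperbolic_set A g f \<Lambda> \<longleftrightarrow>
     compact \<Lambda> \<and> f ` \<Lambda> = \<Lambda> \<and> (\<exists>E F. hyperbolic_splitting A g f \<Lambda> E F)"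

text \<open>The stable bundle of a hyperbolic set is unique, so that the choice below is immaterial.\<close>

definition stable_bundle ::
  "('m::topological_space, 'e::euclidean_space) chart set \<Rightarrow> ('m, 'e) metric_tensor
     \<Rightarrow> ('m \<Rightarrow> 'm) \<Rightarrow> 'm set \<Rightarrow> 'm \<Rightarrow> 'e set" where
  "stable_bundle A g f \<Lambda> = (SOME E. \<exists>F. hyperbolic_splitting A g f \<Lambda> E F)"

definition Anosov ::
  "('m::topological_space, 'e::euclidean_space) chart set \<Rightarrow> ('m, 'e) metric_tensor
     \<Rightarrow> ('m \<Rightarrow> 'm) \<Rightarrow> bool" where
  "Anosov A g f \<longleftrightarrow> C1_diffeo A f \<and> hyperbolic_set A g f UNIV"

definition transitive :: "('m::topological_space \<Rightarrow> 'm) \<Rightarrow> bool" where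
  "transitive f \<longleftrightarrow> (\<exists>x. closure (orbit f x) = UNIV)"

section \<open>Periodic and non-wandering points\<close>

definition Per :: "('m \<Rightarrow> 'm) \<Rightarrow> 'm set" where
  "Per f = {p. \<exists>n\<ge>1. (f ^^ n) p = p}"

definition hyperbolic_periodic ::
  "('m::topological_space, 'e::euclidean_space) chart set \<Rightarrow> ('m, 'e) metric_tensor
     \<Rightarrow> ('m \<Rightarrow> 'm) \<Rightarrow> 'm \<Rightarrow> bool" where
  "hyperbolic_periodic A g f p \<longleftrightarrow> p \<in> Per f \<and> hyperbolic_set A g f (orbit f p)"

definition index ::
  "('m::topological_space, 'e::euclidean_space) chart set \<Rightarrow> ('m, 'e) metric_tensor
     \<Rightarrow> ('m \<Rightarrow> 'm) \<Rightarrow> 'm \<Rightarrow> nat" where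
  "index A g f p = dim (stable_bundle A g f (orbit f p) p)"

definition sink ::
  "('m::topological_space, 'e::euclidean_space) chart set \<Rightarrow> ('m, 'e) metric_tensor
     \<Rightarrow> ('m \<Rightarrow> 'm) \<Rightarrow> 'm \<Rightarrow> bool" where
  "sink A g f p \<longleftrightarrow> hyperbolic_periodic A g f p \<and> index A g f p = DIM('e)"

definition source ::
  "('m::topological_space, 'e::euclidean_space) chart set \<Rightarrow> ('m, 'e) metric_tensor
     \<Rightarrow> ('m \<Rightarrow> 'm) \<Rightarrow> 'm \<Rightarrow> bool" where
  "source A g f p \<longleftrightarrow> hyperbolic_periodic A g f p \<and> index A g f p = 0"

definition nonwandering :: "('m::topological_space \<Rightarrow> 'm) \<Rightarrow> 'm set" where
  "nonwandering f = {p. \<forall>U. open U \<and> p \<in> U \<longrightarrow> (\<exists>n\<ge>1. (f ^^ n) ` U \<inter> U \<noteq> {})}"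

definition Axiom_A ::
  "('m::topological_space, 'e::euclidean_space) chart set \<Rightarrow> ('m, 'e) metric_tensor
     \<Rightarrow> ('m \<Rightarrow> 'm) \<Rightarrow> bool" where
  "Axiom_A A g f \<longleftrightarrow> C1_diffeo A f \<and> nonwandering f = closure (Per f) \<and>
     hyperbolic_set A g f (nonwandering f)"

section \<open>Invariant manifolds and Morse-Smale diffeomorphisms\<close>

definition stable_manifold ::
  "('m::topological_space, 'e::euclidean_space) chart set \<Rightarrow> ('m, 'e) metric_tensor
     \<Rightarrow> ('m \<Rightarrow> 'm) \<Rightarrow> 'm \<Rightarrow> 'm set" where
  "stable_manifold A g f p = {y. (\<lambda>n. riem_dist A g ((f ^^ n) y) ((f ^^ n) p)) \<longlonglongrightarrow> 0}"

definition local_stable_manifold ::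
  "('m::topological_space, 'e::euclidean_space) chart set \<Rightarrow> ('m, 'e) metric_tensor
     \<Rightarrow> ('m \<Rightarrow> 'm) \<Rightarrow> real \<Rightarrow> 'm \<Rightarrow> 'm set" where
  "local_stable_manifold A g f \<epsilon> p =
     {y. \<forall>n. riem_dist A g ((f ^^ n) y) ((f ^^ n) p) \<le> ennreal \<epsilon>}"

text \<open>Vectors tangent at \<open>x\<close> to a set \<open>S\<close>, in particular to an embedded submanifold.\<close>

definition tangent_vectors ::
  "('m::topological_space, 'e::euclidean_space) chart set \<Rightarrow> 'm set \<Rightarrow> 'm \<Rightarrow> 'e set" where
  "tangent_vectors A S x =
     {velocity A \<gamma> 0 |\<gamma> \<delta>. \<delta> > 0 \<and> C1_curve_on A {-\<delta><..<\<delta>} \<gamma> \<and> \<gamma> ` {-\<delta><..<\<delta>} \<subseteq> S \<and> \<gamma> 0 = x}"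

text \<open>
  The stable manifold of a hyperbolic periodic point \<open>p\<close> is only an immersed submanifold, so its
  tangent space cannot be read off from curves in the subset itself. For every small \<open>\<epsilon>\<close>, it is
  the increasing union of the pieces \<open>f\<^sup>-\<^sup>n (W\<^sup>s\<^sub>\<epsilon> (f\<^sup>n p))\<close>, which lie in embedded discs and exhaust
  the stable manifold also in its own topology; its tangent space at \<open>x\<close> is the union of theirs.
  The sets below shrink with \<open>\<epsilon>\<close>, hence the intersection.
\<close>

definition stable_tangent_space ::
  "('m::topological_space, 'e::euclidean_space) chart set \<Rightarrow> ('m, 'e) metric_tensor
     \<Rightarrow> ('m \<Rightarrow> 'm) \<Rightarrow> 'm \<Rightarrow> 'm \<Rightarrow> 'e set" where
  "stable_tangent_space A g f p x =
     (\<Inter>\<epsilon>\<in>{0<..}. \<Union>n. tangent_vectors A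
        ((f ^^ n) -` local_stable_manifold A g f \<epsilon> ((f ^^ n) p)) x)"

text \<open>The unstable manifold of \<open>q\<close> for \<open>f\<close> is the stable manifold of \<open>q\<close> for \<open>inv f\<close>.\<close>

definition transverse_invariant_manifolds ::
  "('m::topological_space, 'e::euclidean_space) chart set \<Rightarrow> ('m, 'e) metric_tensor
     \<Rightarrow> ('m \<Rightarrow> 'm) \<Rightarrow> 'm \<Rightarrow> 'm \<Rightarrow> bool" where
  "transverse_invariant_manifolds A g f p q \<longleftrightarrow>
     (\<forall>x \<in> stable_manifold A g f p \<inter> stable_manifold A g (inv f) q.
        {u + v |u v. u \<in> stable_tangent_space A g f p x \<and>
                     v \<in> stable_tangent_space A g (inv f) q x} = UNIV)"

definition Morse_Smale ::
  "('m::topological_space, 'e::euclidean_space) chart set \<Rightarrow> ('m, 'e) metric_tensor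
     \<Rightarrow> ('m \<Rightarrow> 'm) \<Rightarrow> bool" where
  "Morse_Smale A g f \<longleftrightarrow> C1_diffeo A f \<and>
     finite (nonwandering f) \<and> (\<forall>p\<in>nonwandering f. hyperbolic_periodic A g f p) \<and>
     (\<forall>p\<in>nonwandering f. \<forall>q\<in>nonwandering f. transverse_invariant_manifolds A g f p q)"

end

(* Two-sided limit shadowing, applied to pseudo-orbits that follow one orbit backwards and another
   one forwards, makes f chain transitive. Chains between the points of a countable dense set then
   concatenate to a limit pseudo-orbit, and a point that shadows it has a forward orbit that visits
   every open set infinitely often. Hence every point is non-wandering and f is transitive, so that
   an Axiom A diffeomorphism is Anosov without any appeal to invariant manifolds, and Omega(f), being
   infinite, excludes Morse-Smale. A sink or a source has small trapping neighbourhoods (for f or its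
   inverse), which a recurrent dense forward orbit cannot respect. *)

theory Submission
  imports Defs
begin

section \<open>Charts and differentials\<close>

text \<open>The Riemannian distance is \<open>ennreal\<close>-valued, infinite between components,
  and no metric space structure is available on \<open>'m\<close>. The dynamical part therefore
  works with an arbitrary function \<open>d\<close>, tied to the topology by two local conditions
  only: points of a small enough neighbourhood are \<open>d\<close>-close to each other
  (\<open>small\<close>), and whatever is \<open>d\<close>-close to a point near \<open>x\<close> is
  topologically near \<open>x\<close> (\<open>near\<close>). All analysis on the manifold goes into
  these two facts, through a comparison of the Riemannian with the Euclidean norm over compact sets
  of coordinates. Without a triangle inequality, asymptotic orbits cannot be compared directly; in
  the construction of chains closeness is used only at cluster points, where it turns into
  membership in a fixed open set. The trapping neighbourhoods need an exponent that does not depend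
  on their size: it can then be fixed first, and the neighbourhood shrunk afterwards until all its
  images up to that exponent miss some open set.\<close>

definition diff_map ::
  "('m::topological_space, 'e::euclidean_space) chart set \<Rightarrow> ('m \<Rightarrow> 'm) \<Rightarrow> bool" where
  "diff_map A f \<longleftrightarrow> continuous_on UNIV f \<and>
     (\<forall>c\<in>A. \<forall>c'\<in>A. \<forall>x. x \<in> fst c \<longrightarrow> f x \<in> fst c' \<longrightarrow>
        (snd c' \<circ> f \<circ> chart_inv c) differentiable (at (snd c x)))"

lemma Ck_on_1:
  "Ck_on 1 f S \<longleftrightarrow> f differentiable_on S \<and>
     (\<forall>v. continuous_on S (\<lambda>x. frechet_derivative f (at x) v))"
  unfolding One_nat_def Ck_on.simps by simp

lemma chart_inv_left:
  assumes "is_chart c" "x \<in> fst c"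
  shows "chart_inv c (snd c x) = x"
  using assms by (auto simp: is_chart_def homeomorphism_def)

lemma chart_inv_mem: "z \<in> snd c ` fst c \<Longrightarrow> chart_inv c z \<in> fst c"
  by (rule inv_into_into)

lemma chart_inv_right: "z \<in> snd c ` fst c \<Longrightarrow> snd c (chart_inv c z) = z"
  by (rule f_inv_into_f)

lemma chart_image_vimage:
  assumes "is_chart c"
  shows "snd c ` (fst c \<inter> W) = snd c ` fst c \<inter> chart_inv c -` W"
proof (intro subset_antisym subsetI)
  fix z assume "z \<in> snd c ` (fst c \<inter> W)"
  then show "z \<in> snd c ` fst c \<inter> chart_inv c -` W"
    using chart_inv_left[OF assms] by auto
next
  fix z assume z: "z \<in> snd c ` fst c \<inter> chart_inv c -` W"
  then have "z = snd c (chart_inv c z)" "chart_inv c z \<in> fst c \<inter> W"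
    using chart_inv_mem chart_inv_right by (metis IntE, auto intro: chart_inv_mem)
  then show "z \<in> snd c ` (fst c \<inter> W)" by blast
qed

lemma open_chart_image:
  assumes "is_chart c" "open W"
  shows "open (snd c ` (fst c \<inter> W))"
proof -
  have "continuous_on (snd c ` fst c) (chart_inv c)" "open (snd c ` fst c)"
    using assms by (auto simp: is_chart_def homeomorphism_def)
  then have "open (chart_inv c -` W \<inter> snd c ` fst c)"
    using assms(2) continuous_on_open_vimage by blast
  then show ?thesis
    by (metis chart_image_vimage[OF assms(1)] Int_commute)
qed

lemma open_chart_inv_image:
  assumes "is_chart c" "open S" "S \<subseteq> snd c ` fst c"
  shows "open (chart_inv c ` S)"
proof -
  have "chart_inv c ` S = snd c -` S \<inter> fst c"
  proof (intro subset_antisym subsetI)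
    fix x assume "x \<in> chart_inv c ` S"
    then show "x \<in> snd c -` S \<inter> fst c"
      using assms(3) chart_inv_mem chart_inv_right by (smt (verit) IntI imageE subsetD vimageI)
  next
    fix x assume "x \<in> snd c -` S \<inter> fst c"
    then show "x \<in> chart_inv c ` S" using chart_inv_left[OF assms(1)] by force
  qed
  moreover have "continuous_on (fst c) (snd c)" "open (fst c)"
    using assms by (auto simp: is_chart_def homeomorphism_def)
  ultimately show ?thesis using assms(2) continuous_on_open_vimage by metis
qed

section \<open>Chain rule and coordinate changes\<close>

context
  fixes A :: "('m::topological_space, 'e::euclidean_space) chart set"
  assumes atlas: "smooth_atlas A"
begin

lemma atlas_is_chart: "c \<in> A \<Longrightarrow> is_chart c"
  using atlas by (auto simp: smooth_atlas_def)

lemma chart_at: "chart_at A x \<in> A" "x \<in> fst (chart_at A x)"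
proof -
  have "x \<in> (\<Union>c\<in>A. fst c)" using atlas by (auto simp: smooth_atlas_def)
  then have "\<exists>c. c \<in> A \<and> x \<in> fst c" by blast
  from someI_ex[OF this] show "chart_at A x \<in> A" "x \<in> fst (chart_at A x)"
    by (auto simp: chart_at_def)
qed

text \<open>Only continuity and pointwise differentiability are carried forward: the chain rule
  alone preserves them, so that all iterates are covered at once.\<close>

lemma C1_map_diff_map:
  assumes "C1_map A f"
  shows "diff_map A f"
  unfolding diff_map_def
proof (intro conjI ballI allI impI)
  show cont: "continuous_on UNIV f" using assms by (simp add: C1_map_def)
  fix c c' x assume c: "c \<in> A" "c' \<in> A" "x \<in> fst c" "f x \<in> fst c'"
  have "open (fst c')" using atlas_is_chart[OF c(2)] by (simp add: is_chart_def)
  then have "open (f -` fst c')" using open_vimage[OF _ cont] by simp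
  then have "open (snd c ` (fst c \<inter> f -` fst c'))"
    using open_chart_image atlas_is_chart c by blast
  moreover have "snd c x \<in> snd c ` (fst c \<inter> f -` fst c')" using c by auto
  moreover have "(snd c' \<circ> f \<circ> chart_inv c) differentiable_on (snd c ` (fst c \<inter> f -` fst c'))"
    using assms c unfolding C1_map_def Ck_on_1 by blast
  ultimately show "(snd c' \<circ> f \<circ> chart_inv c) differentiable (at (snd c x))"
    using differentiable_on_eq_differentiable_at by blast
qed

lemma C1_map_id: "C1_map A id"
proof -
  have "Ck_on 1 (snd c' \<circ> id \<circ> chart_inv c) (snd c ` (fst c \<inter> id -` fst c'))"
    if "c \<in> A" "c' \<in> A" for c c'
    using atlas that by (simp add: smooth_atlas_def del: Ck_on.simps)
  then show ?thesis by (simp add: C1_map_def)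
qed

lemmas diff_map_id = C1_map_diff_map[OF C1_map_id]

lemma has_derivative_chart_deriv:
  assumes "diff_map A f" "c \<in> A" "c' \<in> A" "x \<in> fst c" "f x \<in> fst c'"
  shows "((snd c' \<circ> f \<circ> chart_inv c) has_derivative chart_deriv c c' f x) (at (snd c x))"
  using assms unfolding diff_map_def chart_deriv_def frechet_derivative_works by blast

lemma linear_chart_deriv:
  assumes "diff_map A f" "c \<in> A" "c' \<in> A" "x \<in> fst c" "f x \<in> fst c'"
  shows "linear (chart_deriv c c' f x)"
  using has_derivative_chart_deriv[OF assms] by (simp add: has_derivative_linear)

text \<open>Inserting the coordinates of \<open>c'\<close> between \<open>h\<close> and
  \<open>f\<close> is legitimate only where \<open>h\<close> stays in the domain of
  \<open>c'\<close>, because the values of a chart outside its domain are arbitrary. This holds on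
  the open set \<open>?S\<close>, which suffices for a derivative.\<close>

lemma has_derivative_chart_comp:
  assumes f: "diff_map A f" and h: "diff_map A h"
    and c: "c \<in> A" "c' \<in> A" "c'' \<in> A" "x \<in> fst c" "h x \<in> fst c'" "f (h x) \<in> fst c''"
  shows "((snd c'' \<circ> (f \<circ> h) \<circ> chart_inv c) has_derivative
            chart_deriv c' c'' f (h x) \<circ> chart_deriv c c' h x) (at (snd c x))"
proof -
  let ?S = "snd c ` (fst c \<inter> h -` fst c')"
  have inv: "chart_inv c (snd c x) = x"
    using chart_inv_left atlas_is_chart c by blast
  have "continuous_on UNIV h" "open (fst c')"
    using h atlas_is_chart[OF c(2)] by (auto simp: diff_map_def is_chart_def)
  then have "open (h -` fst c')" using open_vimage by blast
  then have S: "open ?S" using open_chart_image atlas_is_chart c by blast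
  have "((snd c' \<circ> h \<circ> chart_inv c) has_derivative chart_deriv c c' h x) (at (snd c x))"
    using has_derivative_chart_deriv[OF h] c by blast
  moreover have "((snd c'' \<circ> f \<circ> chart_inv c') has_derivative chart_deriv c' c'' f (h x))
      (at ((snd c' \<circ> h \<circ> chart_inv c) (snd c x)))"
    using has_derivative_chart_deriv[OF f, of c' c'' "h x"] c inv by simp
  ultimately have "((snd c'' \<circ> f \<circ> chart_inv c') \<circ> (snd c' \<circ> h \<circ> chart_inv c) has_derivative
      chart_deriv c' c'' f (h x) \<circ> chart_deriv c c' h x) (at (snd c x))"
    by (rule diff_chain_at)
  then show ?thesis
  proof (rule has_derivative_transform_within_open[OF _ S])
    show "snd c x \<in> ?S" using c by auto
    fix z assume "z \<in> ?S"
    then have "h (chart_inv c z) \<in> fst c'"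
      using chart_inv_left atlas_is_chart c by fastforce
    then show "((snd c'' \<circ> f \<circ> chart_inv c') \<circ> (snd c' \<circ> h \<circ> chart_inv c)) z =
        (snd c'' \<circ> (f \<circ> h) \<circ> chart_inv c) z"
      using chart_inv_left[OF atlas_is_chart[OF c(2)]] by simp
  qed
qed

lemma chart_deriv_comp:
  assumes "diff_map A f" "diff_map A h"
    and "c \<in> A" "c' \<in> A" "c'' \<in> A" "x \<in> fst c" "h x \<in> fst c'" "f (h x) \<in> fst c''"
  shows "chart_deriv c c'' (f \<circ> h) x = chart_deriv c' c'' f (h x) \<circ> chart_deriv c c' h x"
  using frechet_derivative_at[OF has_derivative_chart_comp[OF assms]]
  by (simp add: chart_deriv_def[of c c''])

lemma diff_map_comp:
  assumes f: "diff_map A f" and h: "diff_map A h"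
  shows "diff_map A (f \<circ> h)"
proof -
  have "continuous_on UNIV (f \<circ> h)"
    using assms by (intro continuous_on_compose) (auto simp: diff_map_def intro: continuous_on_subset)
  moreover have "(snd c' \<circ> (f \<circ> h) \<circ> chart_inv c) differentiable (at (snd c x))"
    if "c \<in> A" "c' \<in> A" "x \<in> fst c" "(f \<circ> h) x \<in> fst c'" for c c' x
    using has_derivative_chart_comp[OF f h that(1) chart_at(1)[of "h x"] that(2,3)] chart_at that
    unfolding differentiable_def by fastforce
  ultimately show ?thesis unfolding diff_map_def by blast
qed

lemma diff_map_funpow:
  assumes "diff_map A f"
  shows "diff_map A (f ^^ n)"
  by (induction n) (simp_all only: funpow.simps diff_map_id diff_map_comp[OF assms])

lemma differential_comp:
  assumes "diff_map A f" "diff_map A h"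
  shows "differential A (f \<circ> h) x = differential A f (h x) \<circ> differential A h x"
  unfolding differential_def using assms chart_at chart_deriv_comp[OF assms] by simp

lemma linear_differential:
  assumes "diff_map A f"
  shows "linear (differential A f x)"
  unfolding differential_def using assms chart_at linear_chart_deriv by blast

lemma chart_deriv_id:
  assumes "c \<in> A" "x \<in> fst c"
  shows "chart_deriv c c id x = id"
proof -
  have "((snd c \<circ> id \<circ> chart_inv c) has_derivative id) (at (snd c x))"
  proof (rule has_derivative_transform_within_open[OF has_derivative_id])
    show "open (snd c ` fst c)" using atlas_is_chart[OF assms(1)] by (simp add: is_chart_def)
  qed (use assms chart_inv_right[of _ c] in auto)
  then show ?thesis unfolding chart_deriv_def by (rule frechet_derivative_at[symmetric])
qed

lemma differential_id: "differential A id x = id"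
  using chart_deriv_id chart_at by (simp add: differential_def)

lemma linear_from_chart:
  assumes "c \<in> A" "x \<in> fst c"
  shows "linear (from_chart A c x)"
  unfolding from_chart_def using linear_chart_deriv[OF diff_map_id] assms chart_at by simp

text \<open>The chain rule for \<open>id \<circ> id\<close> makes \<open>to_chart\<close> a left
  inverse of \<open>from_chart\<close>. Positivity of the metric thereby survives the passage to
  coordinates.\<close>

lemma from_chart_nonzero:
  assumes "c \<in> A" "x \<in> fst c" "v \<noteq> 0"
  shows "from_chart A c x v \<noteq> 0"
proof
  assume *: "from_chart A c x v = 0"
  have "chart_deriv c c (id \<circ> id) x = to_chart A c x \<circ> from_chart A c x"
    unfolding to_chart_def from_chart_def
    using chart_deriv_comp[OF diff_map_id diff_map_id, of c "chart_at A x" c x] assms chart_at by simp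
  then have "v = to_chart A c x (from_chart A c x v)"
    using chart_deriv_id assms by (metis comp_apply comp_id id_apply)
  also have "\<dots> = 0"
    using linear_0[OF linear_chart_deriv[OF diff_map_id, of "chart_at A x" c x]] assms chart_at *
    by (simp add: to_chart_def)
  finally show False using assms by simp
qed

end

section \<open>The Riemannian distance and the topology\<close>

text \<open>If the right side is infinite, nothing has to be shown. Otherwise the derivative is
  Lebesgue integrable, and its integral agrees with the gauge integral, for which the fundamental
  theorem tolerates finitely many exceptional points.\<close>

lemma norm_increment_le_nn_integral:
  fixes \<phi> w :: "real \<Rightarrow> 'e::euclidean_space"
  assumes "finite S" "a \<le> b" "continuous_on {a..b} \<phi>"
    and deriv: "\<And>t. t \<in> {a<..<b} - S \<Longrightarrow> (\<phi> has_vector_derivative w t) (at t)"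
    and cont: "continuous_on ({a<..<b} - S) w"
  shows "ennreal (norm (\<phi> b - \<phi> a)) \<le> (\<integral>\<^sup>+t\<in>{a<..<b} - S. ennreal (norm (w t)) \<partial>lborel)"
proof -
  let ?I = "{a<..<b} - S"
  \<comment> \<open>Off this set \<open>w\<close> is arbitrary; the cut-off makes the integrand
    measurable.\<close>
  define h where "h = (\<lambda>t. indicator ?I t *\<^sub>R w t)"
  have "?I \<in> sets borel" using assms(1) by (simp add: finite_imp_closed)
  then have meas: "h \<in> borel_measurable lborel"
    unfolding h_def using borel_measurable_continuous_on_indicator[OF _ cont] by simp
  have eq: "(\<integral>\<^sup>+t. ennreal (norm (h t)) \<partial>lborel) = (\<integral>\<^sup>+t\<in>?I. ennreal (norm (w t)) \<partial>lborel)"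
    by (rule nn_integral_cong) (simp add: h_def indicator_def)
  show ?thesis
  proof (cases "(\<integral>\<^sup>+t. ennreal (norm (h t)) \<partial>lborel) < \<infinity>")
    case True
    then have int: "integrable lborel h" using meas by (simp add: integrable_iff_bounded)
    have "(w has_integral (\<phi> b - \<phi> a)) {a..b}"
      by (rule fundamental_theorem_of_calculus_interior_strong[OF assms(1,2) deriv assms(3)])
    then have "(h has_integral (\<phi> b - \<phi> a)) {a..b}"
      by (rule has_integral_spike_finite[of "S \<union> {a, b}", rotated 2])
        (use assms(1) in \<open>auto simp: h_def indicator_def\<close>)
    then have "((\<lambda>t. if t \<in> {a..b} then h t else 0) has_integral (\<phi> b - \<phi> a)) UNIV"
      by (simp only: has_integral_restrict_UNIV)
    moreover have "(\<lambda>t. if t \<in> {a..b} then h t else 0) = h"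
      unfolding h_def by (rule ext) (auto simp: indicator_def)
    ultimately have "\<phi> b - \<phi> a = integral\<^sup>L lborel h"
      using has_integral_integral_lborel[OF int] has_integral_unique by metis
    then show ?thesis using integral_norm_bound_ennreal[OF int] eq by simp
  next
    case False
    then show ?thesis using eq by (simp add: less_top[symmetric])
  qed
qed

context
  fixes A :: "('m::topological_space, 'e::euclidean_space) chart set"
    and g :: "('m, 'e) metric_tensor"
  assumes metric: "riemannian_metric A g"
begin

lemma bilinear_metric: "bilinear (g x)"
  using metric by (simp add: riemannian_metric_def)

lemma metric_pos: "v \<noteq> 0 \<Longrightarrow> g x v v > 0"
  using metric by (simp add: riemannian_metric_def)

lemma tnorm_scaleR: "tnorm g x (a *\<^sub>R v) = \<bar>a\<bar> * tnorm g x v"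
proof -
  have "g x (a *\<^sub>R v) (a *\<^sub>R v) = a\<^sup>2 * g x v v"
    by (simp add: bilinear_lmul[OF bilinear_metric] bilinear_rmul[OF bilinear_metric] power2_eq_square)
  then show ?thesis by (simp add: tnorm_def real_sqrt_mult)
qed

lemma tnorm_zero: "tnorm g x 0 = 0"
  using tnorm_scaleR[of x 0 0] by simp

lemma tnorm_pos: "v \<noteq> 0 \<Longrightarrow> tnorm g x v > 0"
  using metric_pos by (simp add: tnorm_def)

end

section \<open>Velocities and norms in a fixed chart\<close>

context
  fixes A :: "('m::topological_space, 'e::euclidean_space) chart set"
  assumes atlas: "smooth_atlas A"
begin

lemma has_vector_derivative_chart_change:
  assumes c: "c \<in> A" "c' \<in> A" "\<gamma> t \<in> fst c'"
    and T: "open T" "t \<in> T" "\<gamma> ` T \<subseteq> fst c"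
    and w: "((snd c \<circ> \<gamma>) has_vector_derivative w) (at t)"
  shows "((snd c' \<circ> \<gamma>) has_vector_derivative chart_deriv c c' id (\<gamma> t) w) (at t)"
proof -
  have tc: "\<gamma> t \<in> fst c" using T by auto
  have D: "((snd c' \<circ> id \<circ> chart_inv c) has_derivative chart_deriv c c' id (\<gamma> t)) (at ((snd c \<circ> \<gamma>) t))"
    using has_derivative_chart_deriv[OF atlas diff_map_id[OF atlas] c(1,2) tc] c(3) by simp
  have "((snd c' \<circ> id \<circ> chart_inv c) \<circ> (snd c \<circ> \<gamma>) has_vector_derivative chart_deriv c c' id (\<gamma> t) w) (at t)"
    by (rule vector_derivative_diff_chain_within[OF w has_derivative_at_withinI[OF D]])
  then show ?thesis
    by (rule has_vector_derivative_transform_within_open[OF _ T(1,2)])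
      (use T(3) chart_inv_left[OF atlas_is_chart[OF atlas c(1)]] in auto)
qed

text \<open>The preferred chart used by \<open>velocity\<close> changes along the curve; estimates
  over an interval of times need one fixed chart.\<close>

lemma velocity_eq_from_chart:
  assumes "c \<in> A" "open T" "t \<in> T" "\<gamma> ` T \<subseteq> fst c"
    "((snd c \<circ> \<gamma>) has_vector_derivative w) (at t)"
  shows "velocity A \<gamma> t = from_chart A c (\<gamma> t) w"
  unfolding velocity_def from_chart_def
  by (rule vector_derivative_at, rule has_vector_derivative_chart_change)
    (use assms chart_at[OF atlas] in auto)

lemma chart_cball:
  assumes "c \<in> A" "x \<in> fst c"
  obtains r where "r > 0" "cball (snd c x) r \<subseteq> snd c ` fst c"
proof -
  have "open (snd c ` fst c)" using atlas_is_chart[OF atlas assms(1)] by (simp add: is_chart_def)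
  then show thesis using that assms(2) open_contains_cball by (metis imageI)
qed

end

context
  fixes A :: "('m::topological_space, 'e::euclidean_space) chart set"
    and g :: "('m, 'e) metric_tensor"
  assumes atlas: "smooth_atlas A" and metric: "riemannian_metric A g"
begin

text \<open>By homogeneity only unit vectors matter, and on the compact set
  \<open>K \<times> sphere 0 1\<close> the quadratic form of the metric has a positive minimum and a
  finite maximum.\<close>

lemma tnorm_chart_bounds:
  assumes c: "c \<in> A" and K: "compact K" "K \<subseteq> snd c ` fst c"
  obtains m M where "m > 0" "M > 0"
    "\<And>x v. x \<in> fst c \<Longrightarrow> snd c x \<in> K \<Longrightarrow> m * norm v \<le> tnorm g x (from_chart A c x v)"
    "\<And>x v. x \<in> fst c \<Longrightarrow> snd c x \<in> K \<Longrightarrow> tnorm g x (from_chart A c x v) \<le> M * norm v"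
proof (cases "K = {}")
  case True
  then show thesis using that[of 1 1] by simp
next
  case False
  define G where "G = (\<lambda>z u v. g (chart_inv c z) (from_chart A c (chart_inv c z) u)
                                               (from_chart A c (chart_inv c z) v))"
  define H where "H = (\<lambda>(z, u). G z u u)"
  have Gcont: "continuous_on K (\<lambda>z. G z u v)" for u v
  proof -
    have "Ck_on 0 (\<lambda>z. G z u v) (snd c ` fst c)"
      using metric c unfolding riemannian_metric_def G_def by blast
    then show ?thesis using K(2) continuous_on_subset by auto
  qed
  have lin: "linear (from_chart A c (chart_inv c z))" if "z \<in> K" for z
    using linear_from_chart[OF atlas c] chart_inv_mem[of z c] that K by blast
  have bil: "bilinear (G z)" if "z \<in> K" for z
  proof -
    have "linear (g (chart_inv c z) u)" "linear (\<lambda>v. g (chart_inv c z) v u)" for u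
      using bilinear_metric[OF metric, of "chart_inv c z"] by (simp_all add: bilinear_def)
    from this[THEN linear_compose[OF lin[OF that], unfolded o_def]]
    show ?thesis by (simp add: bilinear_def G_def)
  qed
  \<comment> \<open>The metric is given as continuous in the base point for fixed vectors only; the
    expansion in the basis yields joint continuity.\<close>
  have expand: "H p = (\<Sum>(i, j)\<in>Basis \<times> Basis. (snd p \<bullet> i) * (snd p \<bullet> j) * G (fst p) i j)"
    if "p \<in> K \<times> sphere 0 1" for p
  proof -
    have B: "bilinear (G (fst p))" using bil that by auto
    have "G (fst p) (snd p) (snd p) = G (fst p) (\<Sum>i\<in>Basis. (snd p \<bullet> i) *\<^sub>R i) (\<Sum>j\<in>Basis. (snd p \<bullet> j) *\<^sub>R j)"
      by (simp add: euclidean_representation)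
    also have "\<dots> = (\<Sum>(i, j)\<in>Basis \<times> Basis. G (fst p) ((snd p \<bullet> i) *\<^sub>R i) ((snd p \<bullet> j) *\<^sub>R j))"
      by (rule bilinear_sum[OF B])
    also have "\<dots> = (\<Sum>(i, j)\<in>Basis \<times> Basis. (snd p \<bullet> i) * (snd p \<bullet> j) * G (fst p) i j)"
      by (rule sum.cong) (auto simp: bilinear_lmul[OF B] bilinear_rmul[OF B])
    finally show ?thesis by (simp add: H_def case_prod_beta)
  qed
  have "continuous_on (K \<times> sphere 0 1) (\<lambda>p. G (fst p) i j)" for i j
    by (rule continuous_on_compose2[OF Gcont, where f = fst]) (auto intro: continuous_intros)
  then have "continuous_on (K \<times> sphere 0 1)
      (\<lambda>p. \<Sum>(i, j)\<in>Basis \<times> Basis. (snd p \<bullet> i) * (snd p \<bullet> j) * G (fst p) i j)"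
    unfolding case_prod_beta by (intro continuous_intros)
  then have Hcont: "continuous_on (K \<times> sphere 0 1) H"
    using expand continuous_on_cong by (metis (no_types, lifting))
  have comp: "compact (K \<times> sphere (0::'e) 1)" "K \<times> sphere (0::'e) 1 \<noteq> {}"
    using K False by (auto intro: compact_Times)
  obtain p where p: "p \<in> K \<times> sphere 0 1" "\<And>q. q \<in> K \<times> sphere 0 1 \<Longrightarrow> H p \<le> H q"
    using continuous_attains_inf[OF comp Hcont] by blast
  obtain p' where p': "p' \<in> K \<times> sphere 0 1" "\<And>q. q \<in> K \<times> sphere 0 1 \<Longrightarrow> H q \<le> H p'"
    using continuous_attains_sup[OF comp Hcont] by blast
  have "snd p \<noteq> 0" using p(1) by (auto simp: sphere_def)
  then have pos: "H p > 0"
    using from_chart_nonzero[OF atlas c] chart_inv_mem[of "fst p" c] p(1) K(2) metric_pos[OF metric]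
    by (auto simp: H_def G_def case_prod_beta)
  have pos': "H p' > 0" using pos p(2)[OF p'(1)] by simp
  have tn: "tnorm g x (from_chart A c x v) = norm v * sqrt (H (snd c x, v /\<^sub>R norm v))"
    "v /\<^sub>R norm v \<in> sphere 0 1"
    if "x \<in> fst c" "snd c x \<in> K" "v \<noteq> 0" for x v
  proof -
    have x: "chart_inv c (snd c x) = x" using chart_inv_left atlas_is_chart[OF atlas] c that by blast
    have "v = norm v *\<^sub>R (v /\<^sub>R norm v)" using that by simp
    then have "from_chart A c x v = norm v *\<^sub>R from_chart A c x (v /\<^sub>R norm v)"
      using linear_scale[OF linear_from_chart[OF atlas c that(1)]] by metis
    then show "tnorm g x (from_chart A c x v) = norm v * sqrt (H (snd c x, v /\<^sub>R norm v))"
      using tnorm_scaleR[OF metric] x by (simp add: H_def G_def tnorm_def)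
    show "v /\<^sub>R norm v \<in> sphere 0 1" using that by simp
  qed
  have z: "tnorm g x (from_chart A c x 0) = 0" if "x \<in> fst c" for x
    using linear_0[OF linear_from_chart[OF atlas c that]] tnorm_zero[OF metric] by simp
  show thesis
  proof (rule that[of "sqrt (H p)" "sqrt (H p')"])
    fix x v assume x: "x \<in> fst c" "snd c x \<in> K"
    have "sqrt (H p) * norm v \<le> tnorm g x (from_chart A c x v) \<and>
        tnorm g x (from_chart A c x v) \<le> sqrt (H p') * norm v"
    proof (cases "v = 0")
      case False
      have "(snd c x, v /\<^sub>R norm v) \<in> K \<times> sphere 0 1" using tn(2)[OF x False] x by simp
      then show ?thesis using tn(1)[OF x False] p(2) p'(2)
        by (simp add: mult.commute[of _ "norm v"] mult_left_mono)
    qed (simp add: z x)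
    then show "sqrt (H p) * norm v \<le> tnorm g x (from_chart A c x v)"
        "tnorm g x (from_chart A c x v) \<le> sqrt (H p') * norm v" by auto
  qed (use pos pos' in auto)
qed

end

section \<open>Comparison of the Riemannian distance with the topology\<close>

context
  fixes A :: "('m::t2_space, 'e::euclidean_space) chart set"
    and g :: "('m, 'e) metric_tensor"
  assumes atlas: "smooth_atlas A" and metric: "riemannian_metric A g"
begin

text \<open>Two points of a small coordinate ball are joined by their coordinate segment, whose
  Riemannian length is at most \<open>M\<close> times its Euclidean length.\<close>

lemma riem_dist_small:
  fixes x :: 'm
  assumes "\<epsilon> > 0"
  obtains V where "open V" "x \<in> V" "\<And>a b. a \<in> V \<Longrightarrow> b \<in> V \<Longrightarrow> riem_dist A g a b < ennreal \<epsilon>"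
proof -
  define c where "c = chart_at A x"
  have c: "c \<in> A" "x \<in> fst c" using chart_at[OF atlas] by (auto simp: c_def)
  have ch: "is_chart c" using atlas_is_chart[OF atlas c(1)] .
  obtain r where r: "r > 0" "cball (snd c x) r \<subseteq> snd c ` fst c" using chart_cball[OF atlas c] .
  obtain m M where M: "M > 0" "\<And>y v. y \<in> fst c \<Longrightarrow> snd c y \<in> cball (snd c x) r \<Longrightarrow>
      tnorm g y (from_chart A c y v) \<le> M * norm v"
    using tnorm_chart_bounds[OF atlas metric c(1) compact_cball r(2)] by metis
  \<comment> \<open>Segments in a ball of radius \<delta> have length at most
    \<open>2 * \<delta>\<close>; the factor 3 leaves room for a strict inequality.\<close>
  define \<delta> where "\<delta> = min r (\<epsilon> / (3 * M))"
  have \<delta>: "\<delta> > 0" "\<delta> \<le> r" "M * (2 * \<delta>) < \<epsilon>"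
  proof -
    show "\<delta> > 0" "\<delta> \<le> r" using r M assms by (auto simp: \<delta>_def)
    have "M * \<delta> \<le> \<epsilon> / 3"
      using M(1) mult_left_mono[of \<delta> "\<epsilon> / (3 * M)" M] by (simp add: \<delta>_def)
    then show "M * (2 * \<delta>) < \<epsilon>" using assms by simp
  qed
  let ?B = "ball (snd c x) \<delta>"
  have B: "?B \<subseteq> cball (snd c x) r" using \<delta> by auto
  show thesis
  proof (rule that[of "chart_inv c ` ?B"])
    show "open (chart_inv c ` ?B)"
      using open_chart_inv_image[OF ch open_ball] B r(2) by blast
    show "x \<in> chart_inv c ` ?B"
      using chart_inv_left[OF ch c(2)] \<delta>(1) by (metis centre_in_ball imageI)
    fix a b assume ab: "a \<in> chart_inv c ` ?B" "b \<in> chart_inv c ` ?B"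
    have "y \<in> fst c \<and> snd c y \<in> ?B" if "y \<in> chart_inv c ` ?B" for y
    proof -
      obtain z where z: "z \<in> ?B" "y = chart_inv c z" using \<open>y \<in> chart_inv c ` ?B\<close> by blast
      then have "z \<in> snd c ` fst c" using B r(2) by blast
      then show ?thesis using chart_inv_mem[of z c] chart_inv_right[of z c] z by simp
    qed
    with ab have ab': "a \<in> fst c" "b \<in> fst c" "snd c a \<in> ?B" "snd c b \<in> ?B"
      by blast+
    define l where "l = linepath (snd c a) (snd c b)"
    define \<gamma> where "\<gamma> = chart_inv c \<circ> l"
    have lB: "l t \<in> ?B" if "t \<in> {0..1}" for t
      using convex_contains_segment[of ?B] convex_ball ab' that linepath_in_path unfolding l_def by blast
    have \<gamma>c: "\<gamma> t \<in> fst c" "snd c (\<gamma> t) = l t" if "t \<in> {0..1}" for t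
      using subsetD[OF subset_trans[OF B r(2)] lB[OF that]] chart_inv_mem[of "l t" c]
        chart_inv_right[of "l t" c] by (auto simp: \<gamma>_def)
    have path: "path \<gamma>"
      unfolding path_def \<gamma>_def
    proof (rule continuous_on_compose)
      show "continuous_on {0..1} l" by (simp add: l_def continuous_on_linepath)
      have "continuous_on (snd c ` fst c) (chart_inv c)"
        using ch by (simp add: is_chart_def homeomorphism_def)
      then show "continuous_on (l ` {0..1}) (chart_inv c)"
        by (rule continuous_on_subset) (use lB B r(2) in blast)
    qed
    have ends: "pathstart \<gamma> = a" "pathfinish \<gamma> = b"
      using chart_inv_left[OF ch] ab' by (auto simp: \<gamma>_def pathstart_def pathfinish_def l_def linepath_def)
    let ?v = "snd c b - snd c a"
    have "(l has_vector_derivative ?v) (at t)" for t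
      unfolding l_def by (rule has_vector_derivative_linepath_within)
    then have der: "((snd c \<circ> \<gamma>) has_vector_derivative ?v) (at t)" if "t \<in> {0<..<1}" for t
      by (rule has_vector_derivative_transform_within_open[OF _ open_greaterThanLessThan that])
        (use \<gamma>c in auto)
    have sub: "\<gamma> ` {0<..<1} \<subseteq> fst c" using \<gamma>c by auto
    \<comment> \<open>The curve is affine in \<open>c\<close>, but the definition tests it in every
      chart of the atlas. The derivative of the coordinate change, continuous because the atlas is
      smooth, transports the constant velocity.\<close>
    have "(snd c' \<circ> \<gamma>) C1_differentiable_on ({0<..<1} \<inter> \<gamma> -` fst c')" if c': "c' \<in> A" for c'
      unfolding C1_differentiable_on_def
    proof (intro exI conjI ballI)
      let ?D = "\<lambda>z. frechet_derivative (snd c' \<circ> id \<circ> chart_inv c) (at z) ?v"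
      fix t assume t: "t \<in> {0<..<1} \<inter> \<gamma> -` fst c'"
      have "((snd c' \<circ> \<gamma>) has_vector_derivative chart_deriv c c' id (\<gamma> t) ?v) (at t)"
        using has_vector_derivative_chart_change[OF atlas c(1) c' _ open_greaterThanLessThan _ sub der] t by auto
      then show "((snd c' \<circ> \<gamma>) has_vector_derivative ?D (l t)) (at t)"
        using t \<gamma>c(2)[of t] by (simp add: chart_deriv_def)
    next
      let ?D = "\<lambda>z. frechet_derivative (snd c' \<circ> id \<circ> chart_inv c) (at z) ?v"
      have "Ck_on 1 (snd c' \<circ> id \<circ> chart_inv c) (snd c ` (fst c \<inter> fst c'))"
        using atlas c(1) c' by (simp add: smooth_atlas_def del: Ck_on.simps)
      then have "continuous_on (snd c ` (fst c \<inter> fst c')) ?D" by (simp only: Ck_on_1)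
      then show "continuous_on ({0<..<1} \<inter> \<gamma> -` fst c') (\<lambda>t. ?D (l t))"
      proof (rule continuous_on_compose2)
        show "continuous_on ({0<..<1} \<inter> \<gamma> -` fst c') l" by (simp add: l_def continuous_on_linepath)
        show "l ` ({0<..<1} \<inter> \<gamma> -` fst c') \<subseteq> snd c ` (fst c \<inter> fst c')"
        proof (rule image_subsetI)
          fix t assume t: "t \<in> {0<..<1} \<inter> \<gamma> -` fst c'"
          then show "l t \<in> snd c ` (fst c \<inter> fst c')"
            using \<gamma>c[of t] by (intro image_eqI[of _ _ "\<gamma> t"]) auto
        qed
      qed
    qed
    then have "C1_curve_on A ({0<..<1} - {}) \<gamma>"
      using continuous_on_subset[OF path[unfolded path_def] greaterThanLessThan_subseteq_atLeastAtMost_iff[THEN iffD2]]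
      by (auto simp: C1_curve_on_def)
    then have "piecewise_C1_curve A \<gamma>"
      using path unfolding piecewise_C1_curve_def by blast
    then have "riem_dist A g a b \<le> curve_length A g \<gamma>"
      unfolding riem_dist_def using ends by (intro INF_lower) auto
    also have "\<dots> \<le> (\<integral>\<^sup>+t\<in>{0..1::real}. ennreal (M * (2 * \<delta>)) \<partial>lborel)"
      unfolding curve_length_def
    proof (rule nn_integral_mono_AE)
      \<comment> \<open>At the end points the velocity is a two-sided derivative about which nothing
        is known; they form a null set.\<close>
      have "AE t in lborel. t \<notin> {0, 1::real}"
        by (rule AE_not_in) (simp add: countable_imp_null_set_lborel)
      then show "AE t in lborel. ennreal (tnorm g (\<gamma> t) (velocity A \<gamma> t)) * indicator {0..1} t
          \<le> ennreal (M * (2 * \<delta>)) * indicator {0..1} t"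
      proof (rule AE_mp, intro AE_I2 impI)
        fix t :: real assume "t \<notin> {0, 1}"
        have "tnorm g (\<gamma> t) (velocity A \<gamma> t) \<le> M * (2 * \<delta>)" if t: "t \<in> {0<..<1}"
        proof -
          have "velocity A \<gamma> t = from_chart A c (\<gamma> t) ?v"
            using velocity_eq_from_chart[OF atlas c(1) open_greaterThanLessThan t sub der[OF t]] .
          moreover have "snd c (\<gamma> t) \<in> cball (snd c x) r" using \<gamma>c(2)[of t] lB[of t] B t by auto
          ultimately have "tnorm g (\<gamma> t) (velocity A \<gamma> t) \<le> M * norm ?v"
            using M(2)[of "\<gamma> t"] \<gamma>c(1)[of t] t by simp
          moreover have "norm ?v \<le> 2 * \<delta>"
            using ab'(3,4) dist_triangle2[of "snd c b" "snd c a" "snd c x"]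
            by (simp add: dist_norm dist_commute norm_minus_commute)
          ultimately show ?thesis using M(1)
            by (meson less_imp_le mult_left_mono order_trans)
        qed
        then show "ennreal (tnorm g (\<gamma> t) (velocity A \<gamma> t)) * indicator {0..1} t
          \<le> ennreal (M * (2 * \<delta>)) * indicator {0..1} t"
          using \<open>t \<notin> {0, 1}\<close> by (auto simp: indicator_def intro: ennreal_leI)
      qed
    qed
    also have "\<dots> = ennreal (M * (2 * \<delta>))"
      by (simp add: nn_integral_cmult_indicator)
    also have "\<dots> < ennreal \<epsilon>" using \<delta> assms by (simp add: ennreal_lessI)
    finally show "riem_dist A g a b < ennreal \<epsilon>" .
  qed
qed

text \<open>A curve that leaves a coordinate ball has to cross the annulus between it and a concentric
  one of half the radius.\<close>

lemma riem_dist_near: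
  fixes x :: 'm
  assumes "open U" "x \<in> U"
  obtains V \<epsilon> where "open V" "x \<in> V" "\<epsilon> > 0"
    "\<And>a b. b \<in> V \<Longrightarrow> riem_dist A g a b < ennreal \<epsilon> \<Longrightarrow> a \<in> U"
proof -
  define c where "c = chart_at A x"
  have c: "c \<in> A" "x \<in> fst c" using chart_at[OF atlas] by (auto simp: c_def)
  have ch: "is_chart c" using atlas_is_chart[OF atlas c(1)] .
  have "open (snd c ` (fst c \<inter> U))" using open_chart_image[OF ch assms(1)] .
  moreover have "snd c x \<in> snd c ` (fst c \<inter> U)" using c assms by auto
  ultimately obtain r where r: "r > 0" "cball (snd c x) r \<subseteq> snd c ` (fst c \<inter> U)"
    using open_contains_cball by metis
  then have rc: "cball (snd c x) r \<subseteq> snd c ` fst c" by blast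
  obtain m M where m: "m > 0" "\<And>y v. y \<in> fst c \<Longrightarrow> snd c y \<in> cball (snd c x) r \<Longrightarrow>
      m * norm v \<le> tnorm g y (from_chart A c y v)"
    using tnorm_chart_bounds[OF atlas metric c(1) compact_cball rc] by metis
  let ?B = "ball (snd c x) r" and ?B' = "ball (snd c x) (r / 2)" and ?K = "cball (snd c x) r"
  have ballsub: "?B \<subseteq> ?K" "?B' \<subseteq> ?B" using r by auto
  show thesis
  \<comment> \<open>The distance bound is the coordinate width \<open>r / 2\<close> of the annulus
    times the lower comparison constant \<open>m\<close>.\<close>
  proof (rule that[of "chart_inv c ` ?B'" "m * (r / 2)"])
    show "open (chart_inv c ` ?B')" using open_chart_inv_image[OF ch open_ball] ballsub rc by blast
    show "x \<in> chart_inv c ` ?B'"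
      using chart_inv_left[OF ch c(2)] r(1) by (metis centre_in_ball half_gt_zero imageI)
    show "m * (r / 2) > 0" using m r by simp
    fix a b assume b: "b \<in> chart_inv c ` ?B'" and ab: "riem_dist A g a b < ennreal (m * (r / 2))"
    show "a \<in> U"
    proof (rule ccontr)
      assume aU: "a \<notin> U"
      have openB: "open (chart_inv c ` ?B)" using open_chart_inv_image[OF ch open_ball] ballsub rc by blast
      have BU: "chart_inv c ` ?B \<subseteq> U"
      proof
        fix y assume "y \<in> chart_inv c ` ?B"
        then obtain z where z: "z \<in> ?B" "y = chart_inv c z" by blast
        then have "z \<in> snd c ` (fst c \<inter> U)" using r(2) ballsub by blast
        then show "y \<in> U" using z chart_inv_left[OF ch] by auto
      qed
      have "ennreal (m * (r / 2)) \<le> curve_length A g \<gamma>"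
        if \<gamma>: "piecewise_C1_curve A \<gamma>" "pathstart \<gamma> = a" "pathfinish \<gamma> = b" for \<gamma>
      proof -
        have cont: "continuous_on {0..1} \<gamma>" using \<gamma>(1) by (simp add: piecewise_C1_curve_def path_def)
        obtain S where S: "finite S" "C1_curve_on A ({0<..<1} - S) \<gamma>"
          using \<gamma>(1) unfolding piecewise_C1_curve_def by blast
        \<comment> \<open>The supremum of \<open>Z\<close> is the last time outside the open ball;
          from then on the single chart \<open>c\<close> describes the curve.\<close>
        define Z where "Z = {0..1} \<inter> \<gamma> -` (- (chart_inv c ` ?B))"
        have "closed Z"
          unfolding Z_def
          by (rule continuous_closed_preimage[OF cont closed_atLeastAtMost closed_Compl[OF openB]])
        moreover have "0 \<in> Z" using \<gamma>(2) aU BU by (auto simp: Z_def pathstart_def)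
        moreover have "bdd_above Z" by (auto simp: Z_def intro!: bdd_aboveI[of _ 1])
        ultimately have "Sup Z \<in> Z" using closed_contains_Sup by blast
        define s where "s = Sup Z"
        have s: "0 \<le> s" "s \<le> 1" "\<gamma> s \<notin> chart_inv c ` ?B"
          using \<open>Sup Z \<in> Z\<close> by (auto simp: Z_def s_def)
        have "\<gamma> 1 \<in> chart_inv c ` ?B'" using b \<gamma>(3) by (simp add: pathfinish_def)
        then have "s \<noteq> 1" using s ballsub by blast
        then have s1: "s < 1" using s by simp
        have in_B: "\<gamma> t \<in> chart_inv c ` ?B" if "t \<in> {s<..1}" for t
          using cSup_upper[OF _ \<open>bdd_above Z\<close>, of t] that s unfolding Z_def s_def by force
        \<comment> \<open>At time \<open>s\<close> the curve is outside the open ball, yet its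
          coordinates are needed there. The image of the closed ball is closed because the space is
          Hausdorff, so the limit from the right stays in it.\<close>
        have "compact (chart_inv c ` ?K)"
          using rc ch continuous_on_subset[of "snd c ` fst c" "chart_inv c"]
          by (intro compact_continuous_image) (auto simp: is_chart_def homeomorphism_def)
        then have "closed (chart_inv c ` ?K)" by (rule compact_imp_closed)
        moreover have "continuous_on (closure {s<..<1}) \<gamma>"
          using cont s s1 by (simp add: continuous_on_subset)
        moreover have "\<gamma> ` {s<..<1} \<subseteq> chart_inv c ` ?K" using in_B ballsub by fastforce
        ultimately have "\<gamma> ` closure {s<..<1} \<subseteq> chart_inv c ` ?K"
          using image_closure_subset by blast
        then have in_K: "\<gamma> t \<in> chart_inv c ` ?K" if "t \<in> {s..1}" for t
          using s1 that by auto
        have \<gamma>c: "\<gamma> t \<in> fst c" "snd c (\<gamma> t) \<in> ?K" if t: "t \<in> {s..1}" for t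
        proof -
          obtain z where z: "z \<in> ?K" "\<gamma> t = chart_inv c z" using in_K[OF t] by blast
          then have "z \<in> snd c ` fst c" using rc by blast
          then show "\<gamma> t \<in> fst c" "snd c (\<gamma> t) \<in> ?K"
            using chart_inv_mem[of z c] chart_inv_right[of z c] z by auto
        qed
        \<comment> \<open>With \<open>m\<close> absorbed into the curve, the integrand of the
          increment bound lies directly below the Riemannian speed.\<close>
        let ?\<phi> = "\<lambda>t. m *\<^sub>R (snd c \<circ> \<gamma>) t" and ?I = "{s<..<1} - S"
        have "(snd c \<circ> \<gamma>) C1_differentiable_on (({0<..<1} - S) \<inter> \<gamma> -` fst c)"
          using S(2) c(1) by (simp add: C1_curve_on_def)
        moreover have "?I \<subseteq> ({0<..<1} - S) \<inter> \<gamma> -` fst c" using \<gamma>c s by auto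
        ultimately have "(snd c \<circ> \<gamma>) C1_differentiable_on ?I" using C1_differentiable_on_subset by blast
        then obtain D where D: "\<And>t. t \<in> ?I \<Longrightarrow> ((snd c \<circ> \<gamma>) has_vector_derivative D t) (at t)"
          "continuous_on ?I D" unfolding C1_differentiable_on_def by blast
        have cont\<phi>: "continuous_on {s..1} (snd c \<circ> \<gamma>)"
        proof (rule continuous_on_compose)
          show "continuous_on {s..1} \<gamma>" using cont s by (auto intro: continuous_on_subset)
          show "continuous_on (\<gamma> ` {s..1}) (snd c)"
            using ch \<gamma>c by (auto simp: is_chart_def homeomorphism_def intro: continuous_on_subset)
        qed
        have "dist (snd c x) (snd c (\<gamma> s)) \<ge> r"
        proof (rule ccontr)
          assume "\<not> ?thesis"
          then have "chart_inv c (snd c (\<gamma> s)) \<in> chart_inv c ` ?B" by (intro imageI) simp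
          then show False using s(3) \<gamma>c(1)[of s] chart_inv_left[OF ch] s1 by simp
        qed
        moreover have "dist (snd c x) (snd c (\<gamma> 1)) < r / 2"
        proof -
          obtain z where z: "z \<in> ?B'" "b = chart_inv c z" using b by blast
          then have "z \<in> snd c ` fst c" using ballsub rc by blast
          then show ?thesis using chart_inv_right[of z c] z \<gamma>(3) by (simp add: pathfinish_def)
        qed
        ultimately have far: "norm (snd c (\<gamma> 1) - snd c (\<gamma> s)) \<ge> r / 2"
          using dist_triangle[of "snd c x" "snd c (\<gamma> s)" "snd c (\<gamma> 1)"] by (simp add: dist_norm)
        have "ennreal (m * (r / 2)) \<le> ennreal (norm (?\<phi> 1 - ?\<phi> s))"
          using far m(1) by (intro ennreal_leI) (simp add: scaleR_diff_right[symmetric])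
        also have "\<dots> \<le> (\<integral>\<^sup>+t\<in>?I. ennreal (norm (m *\<^sub>R D t)) \<partial>lborel)"
        proof (rule norm_increment_le_nn_integral[OF S(1)])
          show "continuous_on {s..1} ?\<phi>" using cont\<phi> by (rule continuous_on_scaleR[OF continuous_on_const])
          show "continuous_on ?I (\<lambda>t. m *\<^sub>R D t)"
            using D(2) by (rule continuous_on_scaleR[OF continuous_on_const])
          show "(?\<phi> has_vector_derivative m *\<^sub>R D t) (at t)" if "t \<in> ?I" for t
            using bounded_linear.has_vector_derivative[OF bounded_linear_scaleR_right D(1)[OF that]] .
        qed (use s1 in simp)
        also have "\<dots> \<le> curve_length A g \<gamma>"
          unfolding curve_length_def
        proof (rule nn_integral_mono)
          fix t
          show "ennreal (norm (m *\<^sub>R D t)) * indicator ?I t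
              \<le> ennreal (tnorm g (\<gamma> t) (velocity A \<gamma> t)) * indicator {0..1} t"
          proof (cases "t \<in> ?I")
            case True
            have "\<gamma> ` {s<..<1} \<subseteq> fst c" using \<gamma>c by auto
            then have "velocity A \<gamma> t = from_chart A c (\<gamma> t) (D t)"
              using velocity_eq_from_chart[OF atlas c(1) open_greaterThanLessThan _ _ D(1)[OF True], of s 1] True
              by auto
            then have "norm (m *\<^sub>R D t) \<le> tnorm g (\<gamma> t) (velocity A \<gamma> t)"
              using m \<gamma>c[of t] True by simp
            then show ?thesis using True s by (auto simp: indicator_def intro: ennreal_leI)
          qed simp
        qed
        finally show ?thesis .
      qed
      then have "ennreal (m * (r / 2)) \<le> riem_dist A g a b"
        unfolding riem_dist_def by (intro INF_greatest) auto
      then show False using ab by simp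
    qed
  qed
qed

end

section \<open>Orbits and limit shadowing\<close>

lemma funpow_inv_cancel:
  assumes "bij f"
  shows "(f ^^ n) ((inv f ^^ n) x) = x" "(inv f ^^ n) ((f ^^ n) x) = x"
proof -
  have "(f ^^ n) ((inv f ^^ n) x) = x \<and> (inv f ^^ n) ((f ^^ n) x) = x"
  proof (induction n arbitrary: x)
    case (Suc n)
    have "(f ^^ Suc n) ((inv f ^^ Suc n) x) = (f ^^ n) (f (inv f ((inv f ^^ n) x)))"
      by (simp only: funpow_Suc_right funpow.simps o_apply) (simp add: funpow_swap1)
    moreover have "(inv f ^^ Suc n) ((f ^^ Suc n) x) = (inv f ^^ n) (inv f (f ((f ^^ n) x)))"
      by (simp only: funpow_Suc_right funpow.simps o_apply) (simp add: funpow_swap1)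
    ultimately show ?case
      using Suc assms by (simp add: bij_is_surj surj_f_inv_f bij_is_inj)
  qed simp
  then show "(f ^^ n) ((inv f ^^ n) x) = x" "(inv f ^^ n) ((f ^^ n) x) = x" by auto
qed

lemma funpow_diff_inv:
  assumes "bij f" "i \<le> n"
  shows "(inv f ^^ i) ((f ^^ n) x) = (f ^^ (n - i)) x" "(f ^^ i) ((inv f ^^ n) x) = (inv f ^^ (n - i)) x"
proof -
  have "(f ^^ n) x = (f ^^ i) ((f ^^ (n - i)) x)" "(inv f ^^ n) x = (inv f ^^ i) ((inv f ^^ (n - i)) x)"
    using assms(2) by (metis add_diff_inverse_nat comp_apply funpow_add not_less)+
  then show "(inv f ^^ i) ((f ^^ n) x) = (f ^^ (n - i)) x" "(f ^^ i) ((inv f ^^ n) x) = (inv f ^^ (n - i)) x"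
    using funpow_inv_cancel[OF assms(1)] by simp_all
qed

lemma int_iter_of_nat: "int_iter f (int n) x = (f ^^ n) x"
  by (simp add: int_iter_def)

lemma int_iter_neg_of_nat: "int_iter f (- int n) x = (inv f ^^ n) x"
  by (cases "n = 0") (simp_all add: int_iter_def)

lemma int_iter_succ:
  assumes "bij f"
  shows "f (int_iter f i x) = int_iter f (i + 1) x"
proof (cases "i \<ge> 0")
  case True
  then have "nat (i + 1) = Suc (nat i)" by simp
  then show ?thesis using True by (simp add: int_iter_def)
next
  case False
  then obtain k where i: "i = - int (Suc k)" using negD[of i] by auto
  then have "int_iter f i x = inv f ((inv f ^^ k) x)" using int_iter_neg_of_nat[of f "Suc k" x] by simp
  moreover have "i + 1 = - int k" using i by simp
  ultimately show ?thesis
    using assms int_iter_neg_of_nat[of f k x] by (simp add: bij_is_surj surj_f_inv_f)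
qed

lemma ennreal_pos_obtain_real:
  assumes "(0::ennreal) < a"
  obtains \<epsilon> :: real where "\<epsilon> > 0" "ennreal \<epsilon> \<le> a"
proof (cases a)
  case (real r)
  then show thesis using assms that[of r] by simp
next
  case top
  then show thesis using that[of 1] by simp
qed

lemma ennreal_tendsto_0_iff_real:
  fixes h :: "'a \<Rightarrow> ennreal"
  shows "(h \<longlongrightarrow> 0) F \<longleftrightarrow> (\<forall>\<epsilon>::real. \<epsilon> > 0 \<longrightarrow> eventually (\<lambda>i. h i < ennreal \<epsilon>) F)"
proof (intro iffI allI impI)
  fix \<epsilon> :: real assume "(h \<longlongrightarrow> 0) F" "\<epsilon> > 0"
  then show "eventually (\<lambda>i. h i < ennreal \<epsilon>) F" by (simp add: order_tendsto_iff)
next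
  assume *: "\<forall>\<epsilon>::real. \<epsilon> > 0 \<longrightarrow> eventually (\<lambda>i. h i < ennreal \<epsilon>) F"
  show "(h \<longlongrightarrow> 0) F"
  proof (rule order_tendstoI)
    fix a :: ennreal assume "0 < a"
    then obtain \<epsilon> where "\<epsilon> > 0" "ennreal \<epsilon> \<le> a" by (rule ennreal_pos_obtain_real)
    then show "eventually (\<lambda>i. h i < a) F"
      using * by (auto elim!: eventually_mono)
  qed simp
qed

lemma ennreal_tendsto_0_two_sided_iff:
  fixes h :: "int \<Rightarrow> ennreal"
  shows "(h \<longlongrightarrow> 0) (filtercomap abs at_top) \<longleftrightarrow>
    (\<forall>\<epsilon>::real. \<epsilon> > 0 \<longrightarrow> (\<exists>N::nat. \<forall>i. \<bar>i\<bar> \<ge> int N \<longrightarrow> h i < ennreal \<epsilon>))"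
proof -
  have "eventually P (filtercomap abs at_top) \<longleftrightarrow> (\<exists>N::nat. \<forall>i::int. \<bar>i\<bar> \<ge> int N \<longrightarrow> P i)" for P
    unfolding eventually_filtercomap_at_top_linorder
    by (metis nat_int_comparison(3) int_nat_eq order_trans nat_le_iff abs_ge_zero)
  then show ?thesis by (simp add: ennreal_tendsto_0_iff_real)
qed

text \<open>At least one step is demanded, so that in an infinite concatenation every chain takes
  time and has a valid starting position.\<close>

definition chain_to :: "('m \<Rightarrow> 'm \<Rightarrow> ennreal) \<Rightarrow> ('m \<Rightarrow> 'm) \<Rightarrow> real \<Rightarrow> 'm \<Rightarrow> 'm \<Rightarrow> bool" where
  "chain_to d f \<epsilon> x y \<longleftrightarrow> (\<exists>n\<ge>1. \<exists>s. s (0::nat) = x \<and> s n = y \<and>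
     (\<forall>i<n. d (f (s i)) (s (Suc i)) < ennreal \<epsilon>))"

lemma chain_to_trans:
  assumes "chain_to d f \<epsilon> x y" "chain_to d f \<epsilon> y z"
  shows "chain_to d f \<epsilon> x z"
proof -
  obtain n s n' s' where n: "n \<ge> 1" "s (0::nat) = x" "s n = y"
      "\<And>i. i < n \<Longrightarrow> d (f (s i)) (s (Suc i)) < ennreal \<epsilon>"
    and n': "n' \<ge> 1" "s' (0::nat) = y" "s' n' = z"
      "\<And>i. i < n' \<Longrightarrow> d (f (s' i)) (s' (Suc i)) < ennreal \<epsilon>"
    using assms unfolding chain_to_def by metis
  define s'' where "s'' = (\<lambda>i. if i \<le> n then s i else s' (i - n))"
  have "d (f (s'' i)) (s'' (Suc i)) < ennreal \<epsilon>" if "i < n + n'" for i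
  proof -
    consider "i < n" | "i = n" | "i > n" by linarith
    then show ?thesis
    proof cases
      case 3
      then have "Suc i - n = Suc (i - n)" by simp
      then show ?thesis using 3 that n'(4)[of "i - n"] by (simp add: s''_def)
    qed (use n n' n'(4)[of 0] in \<open>auto simp: s''_def\<close>)
  qed
  moreover have "s'' 0 = x" "s'' (n + n') = z" "n + n' \<ge> 1" using n n' by (auto simp: s''_def)
  ultimately show ?thesis unfolding chain_to_def by blast
qed

section \<open>Chain transitivity and a recurrent dense orbit for an abstract distance\<close>

context
  fixes d :: "'m::{t2_space, second_countable_topology} \<Rightarrow> 'm \<Rightarrow> ennreal" and f :: "'m \<Rightarrow> 'm"
  assumes compact_UNIV: "compact (UNIV :: 'm set)"
    and bij: "bij f" and cont: "continuous_on UNIV f" and cont_inv: "continuous_on UNIV (inv f)"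
    and small: "\<And>x \<epsilon>. \<epsilon> > 0 \<Longrightarrow>
      \<exists>V. open V \<and> x \<in> V \<and> (\<forall>a\<in>V. \<forall>b\<in>V. d a b < ennreal \<epsilon>)"
    and near: "\<And>x U. open U \<Longrightarrow> x \<in> U \<Longrightarrow>
      \<exists>V \<epsilon>. open V \<and> x \<in> V \<and> \<epsilon> > 0 \<and> (\<forall>b\<in>V. \<forall>a. d a b < ennreal \<epsilon> \<longrightarrow> a \<in> U)"
    and shadowing: "\<And>x. ((\<lambda>i::int. d (f (x i)) (x (i + 1))) \<longlongrightarrow> 0) (filtercomap abs at_top) \<Longrightarrow>
      \<exists>y. ((\<lambda>i. d (int_iter f i y) (x i)) \<longlongrightarrow> 0) (filtercomap abs at_top)"
begin

text \<open>This takes the place of \<open>d x x = 0\<close>: exact orbit steps are admissible for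
  every tolerance.\<close>

lemma dist_refl_less: "\<epsilon> > 0 \<Longrightarrow> d x x < ennreal \<epsilon>"
  using small[of \<epsilon> x] by blast

lemma continuous_funpow: "continuous_on UNIV (f ^^ n)" "continuous_on UNIV (inv f ^^ n)"
proof -
  have "continuous_on UNIV (h ^^ n)" if "continuous_on UNIV h" for h :: "'m \<Rightarrow> 'm"
    by (induction n) (auto intro: continuous_on_compose2[OF that])
  then show "continuous_on UNIV (f ^^ n)" "continuous_on UNIV (inv f ^^ n)"
    using cont cont_inv by auto
qed

text \<open>The limit condition does not see the size of the single jump at time 0, so arbitrary
  pasts and futures can be glued.\<close>

lemma connecting_point:
  obtains y where "\<And>\<epsilon>. \<epsilon> > 0 \<Longrightarrow> \<exists>N. \<forall>n\<ge>N. d ((inv f ^^ n) y) ((inv f ^^ n) p) < ennreal \<epsilon>"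
    and "\<And>\<epsilon>. \<epsilon> > 0 \<Longrightarrow> \<exists>N. \<forall>n\<ge>N. d ((f ^^ n) y) ((f ^^ n) q) < ennreal \<epsilon>"
proof -
  define x where "x = (\<lambda>i. int_iter f i (if i < 0 then p else q))"
  \<comment> \<open>The jump occurs for \<open>i = - 1\<close>, which the bound 2 excludes.\<close>
  have "d (f (x i)) (x (i + 1)) < ennreal \<epsilon>" if "\<bar>i\<bar> \<ge> 2" "\<epsilon> > 0" for i \<epsilon>
    using that int_iter_succ[OF bij] dist_refl_less by (auto simp: x_def)
  then have "((\<lambda>i::int. d (f (x i)) (x (i + 1))) \<longlongrightarrow> 0) (filtercomap abs at_top)"
    unfolding ennreal_tendsto_0_two_sided_iff by (intro allI impI exI[of _ 2]) simp
  from shadowing[OF this] obtain y where y: "\<And>\<epsilon>::real. \<epsilon> > 0 \<Longrightarrow>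
      \<exists>N::nat. \<forall>i. \<bar>i\<bar> \<ge> int N \<longrightarrow> d (int_iter f i y) (x i) < ennreal \<epsilon>"
    unfolding ennreal_tendsto_0_two_sided_iff by blast
  show thesis
  proof (rule that[of y])
    fix \<epsilon> :: real assume "\<epsilon> > 0"
    then obtain N where N: "\<And>i. \<bar>i\<bar> \<ge> int N \<Longrightarrow> d (int_iter f i y) (x i) < ennreal \<epsilon>" using y by blast
    \<comment> \<open>Index 0 belongs to the orbit of \<open>q\<close>; hence \<open>Suc N\<close>,
      which makes the index \<open>- n\<close> negative.\<close>
    have "d ((inv f ^^ n) y) ((inv f ^^ n) p) < ennreal \<epsilon>" if "n \<ge> Suc N" for n
      using N[of "- int n"] that int_iter_neg_of_nat[of f n] by (simp add: x_def)
    moreover have "d ((f ^^ n) y) ((f ^^ n) q) < ennreal \<epsilon>" if "n \<ge> N" for n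
      using N[of "int n"] that int_iter_of_nat[of f n] by (simp add: x_def)
    ultimately show "\<exists>N. \<forall>n\<ge>N. d ((inv f ^^ n) y) ((inv f ^^ n) p) < ennreal \<epsilon>"
      "\<exists>N. \<forall>n\<ge>N. d ((f ^^ n) y) ((f ^^ n) q) < ennreal \<epsilon>" by blast+
  qed
qed

text \<open>The chain is the exact orbit of \<open>x\<close> with only its last point replaced by
  \<open>z\<close>.\<close>

lemma chain_to_orbit:
  assumes "\<epsilon> > 0" "a \<ge> 1" "d ((f ^^ a) x) z < ennreal \<epsilon>"
  shows "chain_to d f \<epsilon> x z"
proof -
  define s where "s = (\<lambda>i. if i < a then (f ^^ i) x else z)"
  have "d (f (s i)) (s (Suc i)) < ennreal \<epsilon>" if "i < a" for i
  proof (cases "Suc i < a")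
    case False
    then have "Suc i = a" using that by simp
    then show ?thesis using assms(3) by (auto simp: s_def)
  qed (simp add: s_def dist_refl_less assms)
  moreover have "s 0 = x" "s a = z" using assms by (auto simp: s_def)
  ultimately show ?thesis using assms(2) unfolding chain_to_def by blast
qed

lemma cluster_point:
  fixes X :: "nat \<Rightarrow> 'm"
  obtains l r where "strict_mono r" "(X \<circ> r) \<longlonglongrightarrow> l"
  using compact_imp_seq_compact[OF compact_UNIV] unfolding seq_compact_def by (metis UNIV_I)

lemma cluster_visits:
  fixes X :: "nat \<Rightarrow> 'm"
  assumes "strict_mono r" "(X \<circ> r) \<longlonglongrightarrow> l" "open U" "l \<in> U"
  shows "\<exists>n\<ge>N. X n \<in> U"
proof -
  have "eventually (\<lambda>k. (X \<circ> r) k \<in> U) sequentially" using topological_tendstoD assms by blast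
  then obtain K where "\<And>k. k \<ge> K \<Longrightarrow> X (r k) \<in> U" by (auto simp: eventually_sequentially)
  then have "X (r (max K N)) \<in> U" "r (max K N) \<ge> N"
    using seq_suble[OF assms(1), of "max K N"] by auto
  then show ?thesis by blast
qed

text \<open>Follow \<open>x\<close> into its \<open>\<omega>\<close>-limit set, cross over along a point connecting the \<open>\<omega>\<close>-limit set of
  \<open>x\<close> to the \<open>\<alpha>\<close>-limit set of \<open>x'\<close>, and arrive at \<open>x'\<close>. Only two jumps are made, both near cluster
  points, so that neither symmetry nor the triangle inequality of the distance is needed.\<close>

lemma chain_transitive:
  assumes \<epsilon>: "\<epsilon> > 0"
  shows "chain_to d f \<epsilon> x x'"
proof -
  obtain z r where z: "strict_mono r" "((\<lambda>n. (f ^^ n) x) \<circ> r) \<longlonglongrightarrow> z" by (rule cluster_point)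
  obtain w q where w: "strict_mono q" "((\<lambda>n. (inv f ^^ n) x') \<circ> q) \<longlonglongrightarrow> w" by (rule cluster_point)
  \<comment> \<open>The connecting orbit of \<open>y\<close> approaches the past of \<open>z\<close>
    and the future of \<open>w\<close> only asymptotically. The cluster points \<open>z'\<close> and
    \<open>w'\<close> are fixed places at which this closeness can be used.\<close>
  obtain z' r' where z': "strict_mono r'" "((\<lambda>n. (inv f ^^ n) z) \<circ> r') \<longlonglongrightarrow> z'" by (rule cluster_point)
  obtain w' q' where w': "strict_mono q'" "((\<lambda>n. (f ^^ n) w) \<circ> q') \<longlonglongrightarrow> w'" by (rule cluster_point)
  obtain y where y: "\<And>\<epsilon>. \<epsilon> > 0 \<Longrightarrow> \<exists>N. \<forall>n\<ge>N. d ((inv f ^^ n) y) ((inv f ^^ n) z) < ennreal \<epsilon>"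
    "\<And>\<epsilon>. \<epsilon> > 0 \<Longrightarrow> \<exists>N. \<forall>n\<ge>N. d ((f ^^ n) y) ((f ^^ n) w) < ennreal \<epsilon>"
    using connecting_point by blast
  obtain V where V: "open V" "z' \<in> V" "\<And>a b. a \<in> V \<Longrightarrow> b \<in> V \<Longrightarrow> d a b < ennreal \<epsilon>"
    using small[OF \<epsilon>] by metis
  obtain W where W: "open W" "w' \<in> W" "\<And>a b. a \<in> W \<Longrightarrow> b \<in> W \<Longrightarrow> d a b < ennreal \<epsilon>"
    using small[OF \<epsilon>] by metis
  obtain V' \<epsilon>1 where V': "open V'" "z' \<in> V'" "\<epsilon>1 > 0"
    "\<And>a b. b \<in> V' \<Longrightarrow> d a b < ennreal \<epsilon>1 \<Longrightarrow> a \<in> V"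
    using near[OF V(1,2)] by metis
  obtain W' \<epsilon>2 where W': "open W'" "w' \<in> W'" "\<epsilon>2 > 0"
    "\<And>a b. b \<in> W' \<Longrightarrow> d a b < ennreal \<epsilon>2 \<Longrightarrow> a \<in> W"
    using near[OF W(1,2)] by metis
  obtain N1 where N1: "\<And>n. n \<ge> N1 \<Longrightarrow> d ((inv f ^^ n) y) ((inv f ^^ n) z) < ennreal \<epsilon>1"
    using y(1)[OF V'(3)] by blast
  obtain N2 where N2: "\<And>n. n \<ge> N2 \<Longrightarrow> d ((f ^^ n) y) ((f ^^ n) w) < ennreal \<epsilon>2"
    using y(2)[OF W'(3)] by blast
  \<comment> \<open>Membership in \<open>V'\<close> brings the iterate of \<open>y\<close> into
    \<open>V\<close>; membership in \<open>V\<close> makes the preimage of \<open>V\<close> a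
    neighbourhood of \<open>z\<close>, which the orbit of \<open>x\<close> visits.\<close>
  obtain i where i: "i \<ge> N1" "(inv f ^^ i) z \<in> V \<inter> V'"
    using cluster_visits[OF z', of "V \<inter> V'" N1] V V' by auto
  \<comment> \<open>The 1 keeps the middle chain, of length \<open>j + i\<close>, nonempty.\<close>
  obtain j where j: "j \<ge> max 1 N2" "(f ^^ j) w \<in> W \<inter> W'"
    using cluster_visits[OF w', of "W \<inter> W'" "max 1 N2"] W W' by blast
  have yV: "(inv f ^^ i) y \<in> V" using V'(4) N1 i by blast
  have yW: "(f ^^ j) y \<in> W" using W'(4)[OF _ N2[of j]] j by auto
  \<comment> \<open>Passing near \<open>z\<close> at time \<open>n\<close> means being in
    \<open>V\<close> at time \<open>n - i\<close>; \<open>Suc i\<close> makes this time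
    positive.\<close>
  obtain n where n: "n \<ge> Suc i" "(f ^^ n) x \<in> (inv f ^^ i) -` V"
    using cluster_visits[OF z, of "(inv f ^^ i) -` V" "Suc i"] i open_vimage[OF V(1) continuous_funpow(2)]
    by blast
  obtain m where m: "m \<ge> Suc j" "(inv f ^^ m) x' \<in> (f ^^ j) -` W"
    using cluster_visits[OF w, of "(f ^^ j) -` W" "Suc j"] j open_vimage[OF W(1) continuous_funpow(1)]
    by blast
  have "chain_to d f \<epsilon> x ((inv f ^^ i) y)"
    using chain_to_orbit[OF \<epsilon>, of "n - i" x] V(3) yV n funpow_diff_inv(1)[OF bij, of i n x] by simp
  moreover have "chain_to d f \<epsilon> ((inv f ^^ i) y) ((inv f ^^ (m - j)) x')"
  proof (rule chain_to_orbit[OF \<epsilon>, of "j + i"])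
    have "(f ^^ (j + i)) ((inv f ^^ i) y) = (f ^^ j) y"
      by (simp add: funpow_add funpow_inv_cancel[OF bij])
    then show "d ((f ^^ (j + i)) ((inv f ^^ i) y)) ((inv f ^^ (m - j)) x') < ennreal \<epsilon>"
      using W(3) yW m funpow_diff_inv(2)[OF bij, of j m x'] by simp
  qed (use j in simp)
  moreover have "chain_to d f \<epsilon> ((inv f ^^ (m - j)) x') x'"
    using chain_to_orbit[OF \<epsilon>, of "m - j"] m funpow_inv_cancel[OF bij] dist_refl_less[OF \<epsilon>] by simp
  ultimately show ?thesis using chain_to_trans by metis
qed

text \<open>Chains between the points of a dense sequence, each repeated infinitely often, concatenate to
  a limit pseudo-orbit; any point shadowing it visits every open set infinitely often. The state
  \<open>(k, j)\<close> is the position \<open>j\<close> in the \<open>k\<close>-th chain.\<close>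

lemma exists_recurrent_dense_orbit:
  "\<exists>y. \<forall>U N. open U \<longrightarrow> U \<noteq> {} \<longrightarrow> (\<exists>n\<ge>N. (f ^^ n) y \<in> U)"
proof -
  obtain D :: "'m set" where D: "countable D" "\<And>X. open X \<Longrightarrow> X \<noteq> {} \<Longrightarrow> \<exists>d\<in>D. d \<in> X"
    using countable_dense_exists by metis
  define e where "e = from_nat_into D"
  have e: "\<exists>n. e n \<in> U" if "open U" "U \<noteq> {}" for U
    using D that from_nat_into_surj[OF D(1)] unfolding e_def by metis
  \<comment> \<open>The first component of pair decoding takes every value infinitely often, so each
    point of the dense sequence recurs as a target.\<close>
  define t where "t = (\<lambda>k. e (fst (prod_decode k)))"
  have "\<exists>n\<ge>1. \<exists>s. s (0::nat) = t k \<and> s n = t (Suc k) \<and>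
      (\<forall>i<n. d (f (s i)) (s (Suc i)) < ennreal (inverse (Suc k)))" for k
    using chain_transitive[of "inverse (Suc k)" "t k" "t (Suc k)"] by (simp add: chain_to_def)
  then obtain len s where len: "\<And>k. len k \<ge> (1::nat)"
    and s: "\<And>k. s k (0::nat) = t k" "\<And>k. s k (len k) = t (Suc k)"
      "\<And>k i. i < len k \<Longrightarrow> d (f (s k i)) (s k (Suc i)) < ennreal (inverse (Suc k))"
    by metis
  define step where "step = (\<lambda>(k, j). if Suc j < len k then (k, Suc j) else (Suc k, 0))"
  define st where "st = (\<lambda>i. (step ^^ i) (0, 0))"
  define pt where "pt = (\<lambda>(k, j). s k j)"
  have st_Suc: "st (Suc i) = step (st i)" and st_0: "st 0 = (0, 0)" for i by (simp_all add: st_def)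
  \<comment> \<open>A step of the state advances by at most one chain; the bound by \<open>i\<close>
    later makes the visiting times large.\<close>
  have inv: "snd (st i) < len (fst (st i)) \<and> fst (st i) \<le> i" for i
  proof (induction i)
    case (Suc i)
    then show ?case using len by (auto simp: st_Suc step_def case_prod_beta Suc_le_eq)
  qed (use len in \<open>simp add: st_0 Suc_le_eq\<close>)
  have jump: "d (f (pt (st i))) (pt (st (Suc i))) < ennreal (inverse (Suc (fst (st i))))" for i
  proof -
    obtain k j where kj: "st i = (k, j)" by fastforce
    then have "j < len k" using inv[of i] by simp
    \<comment> \<open>At the end of a chain the state moves on to \<open>(Suc k, 0)\<close>, but the
      point there is still the end point of the \<open>k\<close>-th chain, so no extra jump
      arises.\<close>
    moreover have "pt (step (k, j)) = s k (Suc j)"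
    proof (cases "Suc j < len k")
      case False
      then have "Suc j = len k" using \<open>j < len k\<close> by simp
      then show ?thesis using s(1)[of "Suc k"] s(2)[of k] by (simp add: step_def pt_def)
    qed (simp add: step_def pt_def)
    ultimately show ?thesis using s(3)[of j k] kj by (simp add: st_Suc pt_def)
  qed
  have hit: "\<exists>i. st i = (k, 0)" for k
  proof (induction k)
    case 0
    then show ?case using st_0 by blast
  next
    case (Suc k)
    then obtain i where i: "st i = (k, 0)" by blast
    obtain l where l: "len k = Suc l" using len[of k] by (cases "len k") auto
    have "j < len k \<longrightarrow> st (i + j) = (k, j)" for j
      by (induction j) (auto simp: i st_Suc step_def)
    then have "st (i + l) = (k, l)" using l by simp
    then have "st (Suc (i + l)) = (Suc k, 0)" using l by (simp add: st_Suc step_def)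
    then show ?case by blast
  qed
  have mono: "fst (st i) \<le> fst (st j)" if "i \<le> j" for i j
    by (rule lift_Suc_mono_le[of "\<lambda>i. fst (st i)", OF _ that])
      (simp add: st_Suc step_def case_prod_beta)
  \<comment> \<open>The negative half is the exact backward orbit of \<open>t 0\<close>, which joins
    the chains at time 0 without a jump.\<close>
  define x where "x = (\<lambda>i. if i \<ge> 0 then pt (st (nat i)) else int_iter f i (t 0))"
  have "((\<lambda>i::int. d (f (x i)) (x (i + 1))) \<longlongrightarrow> 0) (filtercomap abs at_top)"
    unfolding ennreal_tendsto_0_two_sided_iff
  proof (intro allI impI)
    fix \<epsilon> :: real assume \<epsilon>: "\<epsilon> > 0"
    then obtain K where K: "inverse (real (Suc K)) < \<epsilon>" using reals_Archimedean by blast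
    obtain i0 where i0: "st i0 = (K, 0)" using hit by blast
    have "d (f (x i)) (x (i + 1)) < ennreal \<epsilon>" if i: "\<bar>i\<bar> \<ge> int i0" for i
    proof (cases "i \<ge> 0")
      case True
      have "fst (st (nat i)) \<ge> K" using mono[of i0 "nat i"] i0 i True by (simp add: nat_le_iff le_nat_iff)
      then have "inverse (real (Suc (fst (st (nat i))))) \<le> inverse (real (Suc K))"
        by (intro le_imp_inverse_le) auto
      then have "ennreal (inverse (real (Suc (fst (st (nat i)))))) \<le> ennreal \<epsilon>"
        using K by (intro ennreal_leI) linarith
      moreover have "nat (i + 1) = Suc (nat i)" using True by simp
      ultimately show ?thesis
        using jump[of "nat i"] True by (simp add: x_def order.strict_trans2)
    next
      case False
      have "x (i + 1) = int_iter f (i + 1) (t 0)"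
      proof (cases "i + 1 = 0")
        case True
        then show ?thesis using s(1) by (simp add: x_def st_0 pt_def int_iter_def)
      next
        case False': False
        then show ?thesis using False by (simp add: x_def)
      qed
      then show ?thesis
        using False int_iter_succ[OF bij, of i "t 0"] dist_refl_less[OF \<epsilon>] by (simp add: x_def)
    qed
    then show "\<exists>N::nat. \<forall>i. \<bar>i\<bar> \<ge> int N \<longrightarrow> d (f (x i)) (x (i + 1)) < ennreal \<epsilon>" by blast
  qed
  from shadowing[OF this] obtain y where y: "\<And>\<epsilon>::real. \<epsilon> > 0 \<Longrightarrow>
      \<exists>N::nat. \<forall>i. \<bar>i\<bar> \<ge> int N \<longrightarrow> d (int_iter f i y) (x i) < ennreal \<epsilon>"
    unfolding ennreal_tendsto_0_two_sided_iff by blast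
  have "\<exists>n\<ge>N. (f ^^ n) y \<in> U" if U: "open U" "U \<noteq> {}" for U N
  proof -
    obtain m where m: "e m \<in> U" using e[OF U] by blast
    obtain V \<epsilon> where V: "e m \<in> V" "\<epsilon> > 0" "\<And>a b. b \<in> V \<Longrightarrow> d a b < ennreal \<epsilon> \<Longrightarrow> a \<in> U"
      using near[OF U(1) m] by metis
    obtain N' where N': "\<And>i. \<bar>i\<bar> \<ge> int N' \<Longrightarrow> d (int_iter f i y) (x i) < ennreal \<epsilon>"
      using y[OF V(2)] by blast
    \<comment> \<open>Any second component gives the target \<open>e m\<close>; this one pushes
      \<open>k\<close>, and with it the time \<open>i\<close>, beyond both \<open>N\<close> and
      \<open>N'\<close>.\<close>
    define k where "k = prod_encode (m, max N N')"
    have k: "k \<ge> N" "k \<ge> N'" "t k = e m"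
      using le_prod_encode_2[of "max N N'" m] by (auto simp: k_def t_def)
    obtain i where i: "st i = (k, 0)" using hit by blast
    then have "i \<ge> k" using inv[of i] by simp
    moreover have "x (int i) = e m" using i s(1) k by (simp add: x_def pt_def)
    ultimately have "(f ^^ i) y \<in> U" using V(3)[OF V(1)] N'[of "int i"] k int_iter_of_nat[of f i y] by auto
    then show ?thesis using \<open>i \<ge> k\<close> k by (meson order_trans)
  qed
  then show ?thesis by blast
qed

end

section \<open>Consequences of a recurrent dense orbit\<close>

lemma nonwandering_of_recurrent_dense_orbit:
  assumes "\<And>U N. open U \<Longrightarrow> U \<noteq> {} \<Longrightarrow> \<exists>n\<ge>N. (f ^^ n) y \<in> U"
  shows "nonwandering f = UNIV"
proof -
  have "\<exists>n\<ge>1. (f ^^ n) ` U \<inter> U \<noteq> {}" if U: "open U" "p \<in> U" for p U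
  proof -
    obtain n where n: "(f ^^ n) y \<in> U" using assms[of U 0] U by blast
    \<comment> \<open>The second visit is strictly later, so that the return time
      \<open>m - n\<close> is positive.\<close>
    obtain m where m: "m \<ge> Suc n" "(f ^^ m) y \<in> U" using assms[of U "Suc n"] U by blast
    have "(f ^^ m) y = (f ^^ (m - n)) ((f ^^ n) y)"
      using m(1) by (metis Suc_leD comp_apply funpow_add le_add_diff_inverse2)
    then have "(f ^^ (m - n)) ` U \<inter> U \<noteq> {}" using n m(2) by auto
    moreover have "m - n \<ge> 1" using m(1) by simp
    ultimately show ?thesis by blast
  qed
  then show ?thesis by (auto simp: nonwandering_def)
qed

lemma transitive_of_recurrent_dense_orbit:
  assumes "\<And>U N. open U \<Longrightarrow> U \<noteq> {} \<Longrightarrow> \<exists>n\<ge>N. (f ^^ n) y \<in> U"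
  shows "transitive f"
proof -
  have "U \<inter> orbit f y \<noteq> {}" if U: "open U" "U \<noteq> {}" for U
  proof -
    obtain n where "(f ^^ n) y \<in> U" using assms[OF U] by blast
    then show ?thesis using int_iter_of_nat[of f n y] unfolding orbit_def by (metis IntI emptyE rangeI)
  qed
  from this[of "- closure (orbit f y)"] have "- closure (orbit f y) = {}"
    using closure_subset[of "orbit f y"] by (auto simp: open_Compl)
  then have "closure (orbit f y) = UNIV" by auto
  then show ?thesis by (auto simp: transitive_def)
qed

section \<open>Sinks and sources\<close>

text \<open>Homogeneity extends the bound from unit vectors to whole fibres, and invariance of
  \<open>E\<close> and \<open>\<Lambda>\<close> lets it be repeated along the orbit. Only exponents
  that are multiples of \<open>N\<close> are controlled.\<close>

lemma uniformly_contracted_funpow: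
  fixes A :: "('m::topological_space, 'e::euclidean_space) chart set"
  assumes atlas: "smooth_atlas A" and metric: "riemannian_metric A g"
    and \<phi>: "diff_map A \<phi>" and uc: "uniformly_contracted A g \<phi> \<Lambda> E"
    and \<Lambda>: "\<phi> ` \<Lambda> \<subseteq> \<Lambda>" and sub: "\<And>x. x \<in> \<Lambda> \<Longrightarrow> subspace (E x)"
  obtains N where "N \<ge> 1"
    "\<And>x v k. x \<in> \<Lambda> \<Longrightarrow> v \<in> E x \<Longrightarrow>
      tnorm g ((\<phi> ^^ (N * k)) x) (differential A (\<phi> ^^ (N * k)) x v) \<le> (1 / 2) ^ k * tnorm g x v"
proof -
  obtain N where N: "N \<ge> 1" "\<And>x v. x \<in> \<Lambda> \<Longrightarrow> v \<in> E x \<Longrightarrow> tnorm g x v = 1 \<Longrightarrow>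
      tnorm g ((\<phi> ^^ N) x) (differential A (\<phi> ^^ N) x v) < 1 / 2"
    using uc unfolding uniformly_contracted_def by blast
  have in_\<Lambda>: "(\<phi> ^^ k) x \<in> \<Lambda>" if "x \<in> \<Lambda>" for k x
    using that \<Lambda> by (induction k) auto
  have in_E: "differential A (\<phi> ^^ k) x v \<in> E ((\<phi> ^^ k) x)" if "x \<in> \<Lambda>" "v \<in> E x" for k x v
  proof (induction k)
    case 0
    then show ?case using that differential_id[OF atlas] by (simp add: id_def)
  next
    case (Suc k)
    have "differential A (\<phi> ^^ Suc k) x v = differential A \<phi> ((\<phi> ^^ k) x) (differential A (\<phi> ^^ k) x v)"
      using differential_comp[OF atlas \<phi> diff_map_funpow[OF atlas \<phi>]] by simp
    then show ?case using Suc uc in_\<Lambda>[OF that(1)] unfolding uniformly_contracted_def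
      by (metis comp_apply funpow.simps(2) imageI)
  qed
  have half: "tnorm g ((\<phi> ^^ N) x) (differential A (\<phi> ^^ N) x v) \<le> 1 / 2 * tnorm g x v"
    if "x \<in> \<Lambda>" "v \<in> E x" for x v
  proof -
    have lin: "linear (differential A (\<phi> ^^ N) x)"
      using linear_differential[OF atlas diff_map_funpow[OF atlas \<phi>]] .
    show ?thesis
    proof (cases "v = 0")
      case True
      then show ?thesis using linear_0[OF lin] tnorm_zero[OF metric] by simp
    next
      case False
      let ?t = "tnorm g x v"
      define u where "u = (1 / ?t) *\<^sub>R v"
      have t: "?t > 0" using tnorm_pos[OF metric False] .
      then have v: "v = ?t *\<^sub>R u" by (simp add: u_def)
      have "u \<in> E x" "tnorm g x u = 1"
        using sub[OF that(1)] that(2) t tnorm_scaleR[OF metric] by (auto simp: u_def subspace_scale)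
      then have "tnorm g ((\<phi> ^^ N) x) (differential A (\<phi> ^^ N) x u) \<le> 1 / 2" using N(2) that(1) by force
      moreover have "differential A (\<phi> ^^ N) x v = ?t *\<^sub>R differential A (\<phi> ^^ N) x u"
        using v linear_scale[OF lin] by metis
      ultimately show ?thesis
        using t tnorm_scaleR[OF metric] mult_left_mono[of _ "1 / 2" ?t] by (simp add: mult.commute)
    qed
  qed
  have "tnorm g ((\<phi> ^^ (N * k)) x) (differential A (\<phi> ^^ (N * k)) x v) \<le> (1 / 2) ^ k * tnorm g x v"
    if "x \<in> \<Lambda>" "v \<in> E x" for x v k
  proof (induction k)
    case 0
    then show ?case using differential_id[OF atlas] by (simp add: id_def)
  next
    case (Suc k)
    let ?x = "(\<phi> ^^ (N * k)) x" and ?v = "differential A (\<phi> ^^ (N * k)) x v"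
    have eq: "\<phi> ^^ (N * Suc k) = (\<phi> ^^ N) \<circ> (\<phi> ^^ (N * k))" by (simp add: funpow_add)
    have "tnorm g ((\<phi> ^^ N) ?x) (differential A (\<phi> ^^ N) ?x ?v) \<le> 1 / 2 * tnorm g ?x ?v"
      using half in_\<Lambda> in_E that by blast
    also have "\<dots> \<le> 1 / 2 * ((1 / 2) ^ k * tnorm g x v)" using Suc by simp
    finally show ?case
      unfolding eq differential_comp[OF atlas diff_map_funpow[OF atlas \<phi>] diff_map_funpow[OF atlas \<phi>]]
      by simp
  qed
  then show thesis using that N(1) by blast
qed

text \<open>The exponent \<open>n'\<close> is taken so large that the derivative contracts the Euclidean norm of the
  preferred chart, and not only the Riemannian norm.\<close>

lemma contracting_periodic_point_trapping:
  fixes A :: "('m::topological_space, 'e::euclidean_space) chart set"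
  assumes atlas: "smooth_atlas A" and metric: "riemannian_metric A g"
    and \<phi>: "diff_map A \<phi>" and uc: "uniformly_contracted A g \<phi> \<Lambda> E"
    and \<Lambda>: "\<phi> ` \<Lambda> \<subseteq> \<Lambda>" and sub: "\<And>x. x \<in> \<Lambda> \<Longrightarrow> subspace (E x)"
    and p: "p \<in> \<Lambda>" "E p = UNIV" and n: "n \<ge> 1" "(\<phi> ^^ n) p = p"
  shows "\<exists>n'\<ge>1. \<forall>W. open W \<longrightarrow> p \<in> W \<longrightarrow>
    (\<exists>B. open B \<and> p \<in> B \<and> B \<subseteq> W \<and> (\<phi> ^^ n') ` B \<subseteq> B)"
proof -
  obtain N where N: "N \<ge> 1" "\<And>x v k. x \<in> \<Lambda> \<Longrightarrow> v \<in> E x \<Longrightarrow>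
      tnorm g ((\<phi> ^^ (N * k)) x) (differential A (\<phi> ^^ (N * k)) x v) \<le> (1 / 2) ^ k * tnorm g x v"
    using uniformly_contracted_funpow[OF atlas metric \<phi> uc \<Lambda> sub] by metis
  define c where "c = chart_at A p"
  have c: "c \<in> A" "p \<in> fst c" using chart_at[OF atlas] by (auto simp: c_def)
  have ch: "is_chart c" using atlas_is_chart[OF atlas c(1)] .
  \<comment> \<open>In the preferred chart at \<open>p\<close>, tangent vectors are their own
    coordinates, so the norm comparison applies to them directly.\<close>
  have "from_chart A c p = id"
    using chart_deriv_id[OF atlas c] by (simp add: from_chart_def c_def)
  then obtain m M where mM: "m > 0" "M > 0"
      "\<And>v. m * norm v \<le> tnorm g p v" "\<And>v. tnorm g p v \<le> M * norm v"
    using tnorm_chart_bounds[OF atlas metric c(1), of "{snd c p}"] c(2)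
    by (metis compact_sing empty_subsetI id_apply image_eqI insert_subset singletonI)
  \<comment> \<open>The Riemannian norm at \<open>p\<close> lies between \<open>m\<close> and
    \<open>M\<close> times the Euclidean one; a rate below \<open>m / (2 * M)\<close> absorbs both
    constants and leaves the factor 1/2.\<close>
  obtain k where k: "(1 / 2) ^ k < m / (2 * M)"
    using real_arch_pow_inv[of "m / (2 * M)" "1 / 2"] mM by auto
  \<comment> \<open>A multiple of the period, so that the iterate fixes \<open>p\<close>, and at
    least \<open>k\<close>; the factor \<open>N\<close> in \<open>n'\<close> then makes the
    contraction estimate available.\<close>
  define j where "j = n * Suc k"
  define n' where "n' = N * j"
  have "j \<ge> k" using n(1) mult_le_mono[of 1 n k "Suc k"] by (simp add: j_def)
  then have j: "(1 / 2) ^ j < m / (2 * M)"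
    by (intro order.strict_trans1[OF _ k] power_decreasing) auto
  define h where "h = \<phi> ^^ n'"
  have hp: "h p = p"
  proof -
    have "((\<phi> ^^ n) ^^ i) p = p" for i by (induction i) (simp_all add: n(2))
    moreover have "h = (\<phi> ^^ n) ^^ (N * Suc k)" by (simp only: h_def n'_def j_def funpow_mult mult_ac)
    ultimately show ?thesis by simp
  qed
  have dh: "diff_map A h" using diff_map_funpow[OF atlas \<phi>] by (simp add: h_def)
  then have conth: "continuous_on UNIV h" by (simp add: diff_map_def)
  define L where "L = differential A h p"
  have Lc: "L = chart_deriv c c h p" by (simp add: L_def differential_def hp c_def)
  let ?h = "snd c \<circ> h \<circ> chart_inv c" and ?z = "snd c p"
  have der: "(?h has_derivative L) (at ?z)"
    unfolding Lc using has_derivative_chart_deriv[OF atlas dh c(1) c(1) c(2)] c hp by simp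
  have L: "norm (L v) \<le> 1 / 2 * norm v" for v
  proof -
    have "m * norm (L v) \<le> tnorm g p (L v)" by (rule mM)
    also have "\<dots> \<le> (1 / 2) ^ j * tnorm g p v"
      using N(2)[OF p(1), of v j] p(2) hp by (simp add: L_def h_def n'_def)
    also have "\<dots> \<le> (1 / 2) ^ j * (M * norm v)" using mM(4) by (intro mult_left_mono) auto
    also have "\<dots> \<le> m / (2 * M) * (M * norm v)" using j mM by (intro mult_right_mono) auto
    also have "\<dots> = m * (1 / 2 * norm v)" using mM by simp
    finally show ?thesis using mM(1) by simp
  qed
  have hz: "?h ?z = ?z" using chart_inv_left[OF ch c(2)] hp by simp
  \<comment> \<open>A linearization error of 1/4 on top of the factor 1/2 of \<open>L\<close> keeps
    the total below 1, so small coordinate balls around \<open>p\<close> are mapped into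
    themselves.\<close>
  obtain \<delta> where \<delta>: "\<delta> > 0" "\<And>z. norm (z - ?z) < \<delta> \<Longrightarrow>
      norm (?h z - ?h ?z - L (z - ?z)) \<le> 1 / 4 * norm (z - ?z)"
    using der unfolding has_derivative_at_alt by (metis zero_less_divide_1_iff zero_less_numeral)
  have contract: "norm (?h z - ?z) \<le> norm (z - ?z)" if "norm (z - ?z) < \<delta>" for z
    using \<delta>(2)[OF that] L[of "z - ?z"] hz norm_triangle_ineq[of "?h z - ?z - L (z - ?z)" "L (z - ?z)"]
      norm_ge_zero[of "z - ?z"] unfolding hz by (simp del: norm_ge_zero; linarith)
  show ?thesis
  proof (intro exI[of _ n'] conjI allI impI)
    show "n' \<ge> 1" using N(1) n(1) by (simp add: n'_def j_def Suc_le_eq)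
    fix W assume W: "open W" "p \<in> W"
    have "open (fst c)" using ch by (simp add: is_chart_def)
    \<comment> \<open>The image of a point must again lie in the domain of \<open>c\<close>, since
      otherwise it could not be recovered from its coordinates.\<close>
    then have "open (W \<inter> h -` fst c)" using W conth open_vimage by blast
    then have "open (snd c ` (fst c \<inter> (W \<inter> h -` fst c)))" by (rule open_chart_image[OF ch])
    moreover have "?z \<in> snd c ` (fst c \<inter> (W \<inter> h -` fst c))" using c W hp by auto
    ultimately obtain r where r: "r > 0" "ball ?z r \<subseteq> snd c ` (fst c \<inter> (W \<inter> h -` fst c))"
      using open_contains_ball by metis
    define B where "B = chart_inv c ` ball ?z (min r \<delta>)"
    have Bz: "y \<in> W \<and> h y \<in> fst c \<and> snd c y \<in> ball ?z (min r \<delta>) \<and> chart_inv c (snd c y) = y"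
      if "y \<in> B" for y
    proof -
      obtain z where z: "z \<in> ball ?z (min r \<delta>)" "y = chart_inv c z" using \<open>y \<in> B\<close> by (auto simp: B_def)
      then have "z \<in> snd c ` (fst c \<inter> (W \<inter> h -` fst c))" using r(2) by auto
      then obtain x where "x \<in> fst c" "x \<in> W" "h x \<in> fst c" "z = snd c x" by blast
      then show ?thesis using z chart_inv_left[OF ch] by simp
    qed
    have "open B"
      unfolding B_def by (rule open_chart_inv_image[OF ch open_ball]) (use r(2) in auto)
    moreover have "p \<in> B"
      unfolding B_def using chart_inv_left[OF ch c(2)] r(1) \<delta>(1) by (intro image_eqI[of _ _ ?z]) auto
    moreover have "h y \<in> B" if "y \<in> B" for y
    proof -
      have "norm (snd c y - ?z) < min r \<delta>"
        using Bz[OF that] by (simp add: dist_norm norm_minus_commute)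
      moreover have "?h (snd c y) = snd c (h y)" using Bz[OF that] by simp
      ultimately have "norm (snd c (h y) - ?z) < min r \<delta>" using contract[of "snd c y"] by simp
      then have "snd c (h y) \<in> ball ?z (min r \<delta>)" by (simp add: dist_norm norm_minus_commute)
      then have "chart_inv c (snd c (h y)) \<in> B" unfolding B_def by (rule imageI)
      then show ?thesis using chart_inv_left[OF ch] Bz[OF that] by simp
    qed
    ultimately show "\<exists>B. open B \<and> p \<in> B \<and> B \<subseteq> W \<and> (\<phi> ^^ n') ` B \<subseteq> B"
      using Bz by (auto simp: h_def intro!: exI[of _ B])
  qed
qed

text \<open>The model space has dimension at least 1, so a nonempty open subset of it, such as the
  image of a chart, is infinite.\<close>

lemma manifold_infinite:
  fixes A :: "('m::topological_space, 'e::euclidean_space) chart set"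
  assumes "smooth_atlas A"
  shows "infinite (UNIV :: 'm set)"
proof
  assume fin: "finite (UNIV :: 'm set)"
  fix x :: 'm
  let ?c = "chart_at A x"
  have "is_chart ?c" "x \<in> fst ?c" using chart_at[OF assms] atlas_is_chart[OF assms] by auto
  then have "open (snd ?c ` fst ?c)" "snd ?c ` fst ?c \<noteq> {}" by (auto simp: is_chart_def)
  then show False using finite_imp_not_open[of "snd ?c ` fst ?c"] finite_subset[OF subset_UNIV fin] by blast
qed

lemma separate_finite_set_point:
  fixes q :: "'m::t2_space"
  assumes "finite S" "q \<notin> S"
  obtains U V where "open U" "open V" "S \<subseteq> U" "q \<in> V" "U \<inter> V = {}"
proof -
  have "\<forall>s\<in>S. \<exists>U V. open U \<and> open V \<and> s \<in> U \<and> q \<in> V \<and> U \<inter> V = {}"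
    using assms(2) separation_t2 by metis
  then obtain U V where UV: "\<And>s. s \<in> S \<Longrightarrow> open (U s) \<and> open (V s) \<and> s \<in> U s \<and> q \<in> V s \<and> U s \<inter> V s = {}"
    by metis
  show thesis
    by (rule that[of "\<Union>s\<in>S. U s" "\<Inter>s\<in>S. V s"]) (use UV assms(1) in auto)
qed

text \<open>The union \<open>D\<close> of the images of \<open>B\<close> under the first
  \<open>n'\<close> iterates is forward invariant, because the iterate of order \<open>n'\<close>
  returns into \<open>B\<close>. Since \<open>n'\<close> is fixed before \<open>B\<close> is chosen,
  \<open>B\<close> can be so small that all these images stay near the finite orbit of
  \<open>p\<close> and away from a point off it.\<close>

lemma periodic_trapping_region:
  fixes \<phi> :: "'m::t2_space \<Rightarrow> 'm"
  assumes inf: "infinite (UNIV :: 'm set)" and cont: "continuous_on UNIV \<phi>"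
    and n: "n \<ge> 1" "(\<phi> ^^ n) p = p" and n': "n' \<ge> 1"
    and trap: "\<And>W. open W \<Longrightarrow> p \<in> W \<Longrightarrow> \<exists>B. open B \<and> p \<in> B \<and> B \<subseteq> W \<and> (\<phi> ^^ n') ` B \<subseteq> B"
  obtains B D Q where "open B" "B \<noteq> {}" "B \<subseteq> D" "open Q" "Q \<noteq> {}" "D \<inter> Q = {}" "\<phi> ` D \<subseteq> D"
proof -
  let ?O = "(\<lambda>i. (\<phi> ^^ i) p) ` {..<n}"
  have orb: "(\<phi> ^^ i) p \<in> ?O" for i
    using funpow_mod_eq[OF n(2), of i] n(1) by (intro image_eqI[of _ _ "i mod n"]) auto
  obtain q where "q \<notin> ?O" using inf ex_new_if_finite by blast
  then obtain U Q where UQ: "open U" "open Q" "?O \<subseteq> U" "q \<in> Q" "U \<inter> Q = {}"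
    using separate_finite_set_point[of ?O q] by auto
  have contn: "continuous_on UNIV (\<phi> ^^ i)" for i
    by (induction i) (auto intro: continuous_on_compose2[OF cont])
  have "open (\<Inter>i\<in>{..<n'}. (\<phi> ^^ i) -` U)" using open_vimage[OF UQ(1) contn] by auto
  moreover have "p \<in> (\<Inter>i\<in>{..<n'}. (\<phi> ^^ i) -` U)" using orb UQ(3) by auto
  ultimately obtain B where B: "open B" "p \<in> B" "B \<subseteq> (\<Inter>i\<in>{..<n'}. (\<phi> ^^ i) -` U)" "(\<phi> ^^ n') ` B \<subseteq> B"
    using trap by metis
  define D where "D = (\<Union>i\<in>{..<n'}. (\<phi> ^^ i) ` B)"
  have "D \<subseteq> U" using B(3) by (auto simp: D_def)
  have "\<phi> x \<in> D" if "x \<in> D" for x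
  proof -
    obtain i b where ib: "i < n'" "b \<in> B" "x = (\<phi> ^^ i) b" using \<open>x \<in> D\<close> by (auto simp: D_def)
    show ?thesis
    proof (cases "Suc i < n'")
      case True
      then show ?thesis using ib by (auto simp: D_def intro!: bexI[of _ "Suc i"] image_eqI[of _ _ b])
    next
      case False
      then have "Suc i = n'" using ib by simp
      then have "\<phi> x \<in> B" using ib B(4) by auto
      then show ?thesis using n' by (auto simp: D_def intro!: bexI[of _ 0])
    qed
  qed
  moreover have "B \<subseteq> D" using n' by (auto simp: D_def intro!: bexI[of _ 0])
  ultimately show thesis using that[of B D Q] B(1,2) UQ \<open>D \<subseteq> U\<close> by blast
qed

lemma subbundle_subspace: "subbundle A \<Lambda> E \<Longrightarrow> x \<in> \<Lambda> \<Longrightarrow> subspace (E x)"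
  unfolding subbundle_def by (metis IntI subspace_span)

lemma stable_bundle_splitting:
  assumes "hyperbolic_set A g f \<Lambda>"
  obtains F where "hyperbolic_splitting A g f \<Lambda> (stable_bundle A g f \<Lambda>) F"
  using assms someI_ex[of "\<lambda>E. \<exists>F. hyperbolic_splitting A g f \<Lambda> E F"]
  unfolding hyperbolic_set_def stable_bundle_def by blast

lemma orbit_self: "p \<in> orbit f p"
  unfolding orbit_def using int_iter_of_nat[of f 0 p] by (metis funpow_0 rangeI)

section \<open>Exclusion of sinks and sources\<close>

context
  fixes A :: "('m::t2_space, 'e::euclidean_space) chart set"
    and g :: "('m, 'e) metric_tensor" and f :: "'m \<Rightarrow> 'm" and y :: 'm
  assumes atlas: "smooth_atlas A" and metric: "riemannian_metric A g" and diffeo: "C1_diffeo A f"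
    and recurrent: "\<And>U N. open U \<Longrightarrow> U \<noteq> {} \<Longrightarrow> \<exists>n\<ge>N. (f ^^ n) y \<in> U"
begin

text \<open>Full index makes the stable fibre at \<open>p\<close> the whole tangent space, which
  supplies the trapping region: after a visit to \<open>B\<close> the orbit of \<open>y\<close>
  stays in \<open>D\<close> and can never return to \<open>Q\<close>.\<close>

lemma no_sink: "\<not> sink A g f p"
proof
  assume "sink A g f p"
  then have hyp: "hyperbolic_set A g f (orbit f p)" and "p \<in> Per f"
    and dim: "dim (stable_bundle A g f (orbit f p) p) = DIM('e)"
    by (auto simp: sink_def hyperbolic_periodic_def index_def)
  then obtain n where n: "n \<ge> 1" "(f ^^ n) p = p" by (auto simp: Per_def)
  obtain F where F: "hyperbolic_splitting A g f (orbit f p) (stable_bundle A g f (orbit f p)) F"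
    using stable_bundle_splitting[OF hyp] .
  let ?E = "stable_bundle A g f (orbit f p)"
  have sub: "subspace (?E x)" if "x \<in> orbit f p" for x
    using F that subbundle_subspace unfolding hyperbolic_splitting_def by blast
  have full: "?E p = UNIV" using dim sub[OF orbit_self] by (metis dim_eq_full span_eq_iff)
  have df: "diff_map A f"
    using C1_map_diff_map[OF atlas] diffeo by (simp add: C1_diffeo_def)
  have uc: "uniformly_contracted A g f (orbit f p) ?E" using F by (simp add: hyperbolic_splitting_def)
  have orb: "f ` orbit f p \<subseteq> orbit f p" using hyp by (simp add: hyperbolic_set_def)
  obtain n' where n': "n' \<ge> 1" "\<And>W. open W \<Longrightarrow> p \<in> W \<Longrightarrow>
      \<exists>B. open B \<and> p \<in> B \<and> B \<subseteq> W \<and> (f ^^ n') ` B \<subseteq> B"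
    using contracting_periodic_point_trapping[OF atlas metric df uc orb sub orbit_self full n] by blast
  have cont: "continuous_on UNIV f" using df by (simp add: diff_map_def)
  obtain B D Q where BD: "open B" "B \<noteq> {}" "B \<subseteq> D" "open Q" "Q \<noteq> {}" "D \<inter> Q = {}" "f ` D \<subseteq> D"
    by (rule periodic_trapping_region[OF manifold_infinite[OF atlas] cont n n'])
  obtain i where i: "(f ^^ i) y \<in> B" using recurrent[OF BD(1,2)] by blast
  obtain k where k: "k \<ge> i" "(f ^^ k) y \<in> Q" using recurrent[OF BD(4,5)] by blast
  from k(1) have "(f ^^ k) y \<in> D"
    by (induction k rule: dec_induct) (use i BD in auto)
  then show False using k BD by blast
qed

text \<open>The trapping region \<open>D\<close> is now forward invariant under
  \<open>inv f\<close>, so its complement is forward invariant under \<open>f\<close>. The order of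
  the visits is reversed: after a visit to \<open>Q\<close> the orbit can never reach
  \<open>B\<close>.\<close>

lemma no_source: "\<not> source A g f p"
proof
  assume "source A g f p"
  then have hyp: "hyperbolic_set A g f (orbit f p)" and "p \<in> Per f"
    and dim: "dim (stable_bundle A g f (orbit f p) p) = 0"
    by (auto simp: source_def hyperbolic_periodic_def index_def)
  then obtain n where n: "n \<ge> 1" "(f ^^ n) p = p" by (auto simp: Per_def)
  have bij: "bij f" using diffeo by (simp add: C1_diffeo_def)
  have n_inv: "(inv f ^^ n) p = p" using funpow_inv_cancel(2)[OF bij, of n p] n(2) by simp
  obtain F where F: "hyperbolic_splitting A g f (orbit f p) (stable_bundle A g f (orbit f p)) F"
    using stable_bundle_splitting[OF hyp] .
  let ?E = "stable_bundle A g f (orbit f p)"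
  have sub: "subspace (F x)" if "x \<in> orbit f p" for x
    using F that subbundle_subspace unfolding hyperbolic_splitting_def by blast
  \<comment> \<open>A trivial stable fibre leaves the whole tangent space at \<open>p\<close> to
    \<open>F\<close>, which \<open>inv f\<close> contracts.\<close>
  have E0: "?E p \<subseteq> {0}" using dim by simp
  have sum: "{u + v |u v. u \<in> ?E p \<and> v \<in> F p} = UNIV"
    using F orbit_self[of p f] by (simp add: hyperbolic_splitting_def)
  have "v \<in> F p" for v
  proof -
    obtain u w where "v = u + w" "u \<in> ?E p" "w \<in> F p" using UNIV_I[of v] unfolding sum[symmetric] by blast
    then show ?thesis using E0 by auto
  qed
  then have full: "F p = UNIV" by blast
  have df: "diff_map A (inv f)"
    using C1_map_diff_map[OF atlas] diffeo by (simp add: C1_diffeo_def)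
  have uc: "uniformly_contracted A g (inv f) (orbit f p) F" using F by (simp add: hyperbolic_splitting_def)
  have orb: "inv f ` orbit f p \<subseteq> orbit f p"
    using hyp bij by (metis bij_is_inj hyperbolic_set_def image_inv_f_f order_refl)
  obtain n' where n': "n' \<ge> 1" "\<And>W. open W \<Longrightarrow> p \<in> W \<Longrightarrow>
      \<exists>B. open B \<and> p \<in> B \<and> B \<subseteq> W \<and> (inv f ^^ n') ` B \<subseteq> B"
    using contracting_periodic_point_trapping[OF atlas metric df uc orb sub orbit_self full n(1) n_inv]
    by blast
  have cont: "continuous_on UNIV (inv f)" using df by (simp add: diff_map_def)
  obtain B D Q where BD: "open B" "B \<noteq> {}" "B \<subseteq> D" "open Q" "Q \<noteq> {}" "D \<inter> Q = {}" "inv f ` D \<subseteq> D"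
    by (rule periodic_trapping_region[OF manifold_infinite[OF atlas] cont n(1) n_inv n'])
  obtain i where i: "(f ^^ i) y \<in> Q" using recurrent[OF BD(4,5)] by blast
  obtain k where k: "k \<ge> i" "(f ^^ k) y \<in> B" using recurrent[OF BD(1,2)] by blast
  from k(1) have "(f ^^ k) y \<notin> D"
  proof (induction k rule: dec_induct)
    case base
    then show ?case using i BD by blast
  next
    case (step j)
    have "inv f ((f ^^ Suc j) y) = (f ^^ j) y" using bij by (simp add: bij_is_inj)
    then show ?case using step BD(7) by (metis image_subset_iff)
  qed
  then show False using k BD by blast
qed

end

section \<open>Application to the Riemannian distance and conclusion\<close>

lemma shadowing_recurrent_dense_orbit:
  fixes A :: "('m::{t2_space, second_countable_topology}, 'e::euclidean_space) chart set"
  assumes atlas: "smooth_atlas A" and metric: "riemannian_metric A g"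
    and "compact (UNIV :: 'm set)" "C1_diffeo A f" "two_sided_limit_shadowing A g f"
  obtains y where "\<And>U N. open U \<Longrightarrow> U \<noteq> {} \<Longrightarrow> \<exists>n\<ge>N. (f ^^ n) y \<in> U"
proof -
  have "\<exists>y. \<forall>U N. open U \<longrightarrow> U \<noteq> {} \<longrightarrow> (\<exists>n\<ge>N. (f ^^ n) y \<in> U)"
  proof (rule exists_recurrent_dense_orbit[where d = "riem_dist A g"])
    fix x :: 'm and \<epsilon> :: real assume "\<epsilon> > 0"
    then show "\<exists>V. open V \<and> x \<in> V \<and> (\<forall>a\<in>V. \<forall>b\<in>V. riem_dist A g a b < ennreal \<epsilon>)"
      using riem_dist_small[OF atlas metric] by metis
  next
    fix x :: 'm and U assume "open U" "x \<in> U"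
    then show "\<exists>V \<epsilon>. open V \<and> x \<in> V \<and> \<epsilon> > 0 \<and> (\<forall>b\<in>V. \<forall>a. riem_dist A g a b < ennreal \<epsilon> \<longrightarrow> a \<in> U)"
      using riem_dist_near[OF atlas metric] by metis
  next
    fix x assume "((\<lambda>i::int. riem_dist A g (f (x i)) (x (i + 1))) \<longlongrightarrow> 0) (filtercomap abs at_top)"
    then show "\<exists>y. ((\<lambda>i. riem_dist A g (int_iter f i y) (x i)) \<longlongrightarrow> 0) (filtercomap abs at_top)"
      using assms(5) unfolding two_sided_limit_shadowing_def two_sided_limit_pseudo_orbit_def
        two_sided_limit_shadowed_def by blast
  qed (use assms in \<open>simp_all add: C1_diffeo_def C1_map_def\<close>)
  then show thesis using that by blast
qed

theorem theorem2:
  fixes A :: "('m::{t2_space, second_countable_topology}, 'e::euclidean_space) chart set"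
    and g :: "('m, 'e) metric_tensor"
  assumes "smooth_atlas A"
    and "compact (UNIV :: 'm set)"
    and "riemannian_metric A g"
  shows "(\<forall>f. C1_diffeo A f \<and> two_sided_limit_shadowing A g f \<longrightarrow>
            (\<nexists>p. sink A g f p) \<and> (\<nexists>p. source A g f p) \<and>
            (Axiom_A A g f \<longrightarrow> transitive f \<and> Anosov A g f)) \<and>
         (\<forall>f. Morse_Smale A g f \<longrightarrow> \<not> two_sided_limit_shadowing A g f)"
proof (intro conjI allI impI)
  fix f assume f: "C1_diffeo A f \<and> two_sided_limit_shadowing A g f"
  then obtain y where y: "\<And>U N. open U \<Longrightarrow> U \<noteq> {} \<Longrightarrow> \<exists>n\<ge>N. (f ^^ n) y \<in> U"
    using shadowing_recurrent_dense_orbit[OF assms(1,3,2)] by metis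
  show "\<nexists>p. sink A g f p" using no_sink[OF assms(1,3) _ y] f by blast
  show "\<nexists>p. source A g f p" using no_source[OF assms(1,3) _ y] f by blast
  assume "Axiom_A A g f"
  then show "Anosov A g f"
    using nonwandering_of_recurrent_dense_orbit[OF y] by (simp add: Axiom_A_def Anosov_def)
  show "transitive f" using transitive_of_recurrent_dense_orbit[OF y] .
next
  fix f assume MS: "Morse_Smale A g f"
  show "\<not> two_sided_limit_shadowing A g f"
  proof
    assume "two_sided_limit_shadowing A g f"
    then obtain y where y: "\<And>U N. open U \<Longrightarrow> U \<noteq> {} \<Longrightarrow> \<exists>n\<ge>N. (f ^^ n) y \<in> U"
      using shadowing_recurrent_dense_orbit[OF assms(1,3,2)] MS unfolding Morse_Smale_def by metis
    then show False
      using nonwandering_of_recurrent_dense_orbit[OF y] MS manifold_infinite[OF assms(1)]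
      by (simp add: Morse_Smale_def)
  qed
qed

end
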